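(* Fix any reference input $w$ as in the context that is minimum-phase (i.e. $\hat w$ has no zeros in the closed right half-plane). For a plant $P$ as in the context let $\gamma(P)\in(0,+\infty]$ be the smallest value among those poles and zeros of $P$ that lie on the positive real axis, with $\gamma(P)=+\infty$ if there are none. Let $\mathcal{A}$ be a class of all plants which have the same value $\gamma$ of $\gamma(P)$ and have the same poles and zeros in the region $\{s\in\mathbb{C}\mid\operatorname{Re}s\ge\gamma\}$. Then all plants in $\mathcal{A}$ have the same value of $$\mathrm{OS}_{\mathrm{opt}}(P):=\inf_{e\in\mathcal{F}_P}\ \sup_{t\ge0}(-e(t))_+ .$$ If the reference input is also non-negative ($w(t)\ge0$ for all $t\ge0$), then all plants in $\mathcal{A}$ have the same value of $$\mathrm{US}_{\mathrm{opt}}(P):=\inf_{e\in\mathcal{F}_P}\ \sup_{t\ge0}(e(t)-w(t))_+ .$$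
   Context: $\mathbb{R}_+=[0,\infty)$; $\hat g$ denotes the Laplace transform of $g$; $\lambda_+=\max(\lambda,0)$. $C_0(\mathbb{R}_+)$ is the space of continuous $\varphi:\mathbb{R}_+\to\mathbb{R}$ with $\lim_{t\to\infty}\varphi(t)=0$. $\mathcal{S}$ is the set of proper real-rational functions with no poles in the closed right half-plane. Reference input: $w:\mathbb{R}_+\to\mathbb{R}$ is an ordinary function (no delta terms) with rational Laplace transform $\hat w$ having a zero of some finite order $\theta_w\ge1$ at infinity. Plants: $P$ is a proper real-rational function (with a zero of some finite order $\theta_p\ge0$ at infinity) whose poles and zeros in the closed right half-plane $\{\operatorname{Re}s\ge0\}$ are simple, mutually distinct and not on the imaginary axis. For such $P$ let $P=\hat n/\hat d$ be a coprime factorization with $\hat n,\hat d\in\mathcal{S}$, and let $\hat x,\hat v\in\mathcal{S}$ satisfy $\hat x\hat n+\hat v\hat d=1$. The set of closed-loop error signals tending to zero that are achievable by rational stabilising controllers is $\mathcal{F}_P=\{e\in C_0(\mathbb{R}_+)\mid \hat e=\hat w\hat d(\hat v-\hat q\hat n)\text{ for some }\hat q\in\mathcal{S}\}$.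
   Formalization: Plants are compared only if both sets F_P are nonempty (a right half-plane pole of ŵ at a zero of P empties F_P); for OS_opt with w(0)<0, a plant with θ_p=0 is not compared with one with θ_p≥1 (w=−1, P=1 versus 1/(s+1) gives 0 versus at least 1). *)

theory Defs
  imports
    "HOL-Analysis.Analysis"
    "HOL-Computational_Algebra.Field_as_Ring"
    "HOL-Computational_Algebra.Polynomial_Factorial"
    "HOL-Computational_Algebra.Normalized_Fraction"
begin

text \<open>
  Real-rational functions are elements of the field of fractions of \<open>real poly\<close>. The
  numerator and denominator below are those of the reduced fraction (coprime, monic
  denominator), so common factors are cancelled before zeros, poles, degrees and values are
  read off.
\<close>

type_synonym ratfun = "real poly fract"

definition rnum :: "ratfun \<Rightarrow> real poly" where
  "rnum F = fst (quot_of_fract F)"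

definition rden :: "ratfun \<Rightarrow> real poly" where
  "rden F = snd (quot_of_fract F)"

abbreviation cpoly :: "real poly \<Rightarrow> complex poly" where
  "cpoly p \<equiv> map_poly complex_of_real p"

definition rat_eval :: "ratfun \<Rightarrow> complex \<Rightarrow> complex" where
  "rat_eval F s = poly (cpoly (rnum F)) s / poly (cpoly (rden F)) s"

definition is_zero_of :: "ratfun \<Rightarrow> complex \<Rightarrow> bool" where
  "is_zero_of F s \<longleftrightarrow> poly (cpoly (rnum F)) s = 0"

definition is_pole_of :: "ratfun \<Rightarrow> complex \<Rightarrow> bool" where
  "is_pole_of F s \<longleftrightarrow> poly (cpoly (rden F)) s = 0"

definition proper :: "ratfun \<Rightarrow> bool" where
  "proper F \<longleftrightarrow> degree (rnum F) \<le> degree (rden F)"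

definition zero_at_infinity :: "ratfun \<Rightarrow> nat \<Rightarrow> bool" where
  "zero_at_infinity F k \<longleftrightarrow> F \<noteq> 0 \<and> degree (rden F) = degree (rnum F) + k"

definition stable_ratfuns :: "ratfun set" where
  "stable_ratfuns = {F. proper F \<and> (\<forall>s. Re s \<ge> 0 \<longrightarrow> \<not> is_pole_of F s)}"

text \<open>
  The defining integral is only required to converge on some right half-plane, so a reference
  input may grow exponentially.
\<close>

definition has_laplace :: "(real \<Rightarrow> real) \<Rightarrow> ratfun \<Rightarrow> bool" where
  "has_laplace f F \<longleftrightarrow>
     (\<exists>a. \<forall>s. Re s > a \<longrightarrow>
        set_integrable lborel {0..} (\<lambda>t. exp (- s * of_real t) * complex_of_real (f t)) \<and>
        (LINT t:{0..}|lborel. exp (- s * of_real t) * complex_of_real (f t)) = rat_eval F s)"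

text \<open>
  Signals on the half-line are functions on \<open>real\<close> of which only the values at \<open>t \<ge> 0\<close> are used.
\<close>

definition C0 :: "(real \<Rightarrow> real) set" where
  "C0 = {f. continuous_on {0..} f \<and> (f \<longlongrightarrow> 0) at_top}"

text \<open>
  A rational transform determines \<open>w\<close> up to a null set; the continuity assumption selects the
  canonical representative, on whose point values the suprema below depend.
\<close>

definition reference_input :: "(real \<Rightarrow> real) \<Rightarrow> ratfun \<Rightarrow> bool" where
  "reference_input w W \<longleftrightarrow>
     continuous_on {0..} w \<and> has_laplace w W \<and> (\<exists>k\<ge>1. zero_at_infinity W k)"

definition minimum_phase :: "ratfun \<Rightarrow> bool" where
  "minimum_phase W \<longleftrightarrow> (\<forall>s. Re s \<ge> 0 \<longrightarrow> \<not> is_zero_of W s)"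

definition plant :: "ratfun \<Rightarrow> bool" where
  "plant P \<longleftrightarrow>
     (\<exists>k. zero_at_infinity P k) \<and>
     (\<forall>s. Re s \<ge> 0 \<and> is_zero_of P s \<longrightarrow>
        order s (cpoly (rnum P)) = 1 \<and> \<not> is_pole_of P s \<and> Re s \<noteq> 0) \<and>
     (\<forall>s. Re s \<ge> 0 \<and> is_pole_of P s \<longrightarrow>
        order s (cpoly (rden P)) = 1 \<and> \<not> is_zero_of P s \<and> Re s \<noteq> 0)"

definition bezout_factorization ::
    "ratfun \<Rightarrow> ratfun \<Rightarrow> ratfun \<Rightarrow> ratfun \<Rightarrow> ratfun \<Rightarrow> bool" where
  "bezout_factorization P n d x v \<longleftrightarrow>
     n \<in> stable_ratfuns \<and> d \<in> stable_ratfuns \<and> x \<in> stable_ratfuns \<and> v \<in> stable_ratfuns \<and>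
     d \<noteq> 0 \<and> P = n / d \<and> x * n + v * d = 1"

text \<open>
  The set does not depend on which factorization \<open>n, d, x, v\<close> is used: another choice only
  re-parametrizes \<open>q\<close>.
\<close>

definition error_signals :: "ratfun \<Rightarrow> ratfun \<Rightarrow> (real \<Rightarrow> real) set" where
  "error_signals W P =
     {e \<in> C0. \<exists>n d x v. bezout_factorization P n d x v \<and>
        (\<exists>q \<in> stable_ratfuns. has_laplace e (W * d * (v - q * n)))}"

definition OS_opt :: "ratfun \<Rightarrow> ratfun \<Rightarrow> ereal" where
  "OS_opt W P = (INF e \<in> error_signals W P. SUP t \<in> {0..}. ereal (max (- e t) 0))"

definition US_opt :: "(real \<Rightarrow> real) \<Rightarrow> ratfun \<Rightarrow> ratfun \<Rightarrow> ereal" where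
  "US_opt w W P = (INF e \<in> error_signals W P. SUP t \<in> {0..}. ereal (max (e t - w t) 0))"

text \<open>The infimum is over a finite set, and is \<open>\<infinity>\<close> when that set is empty.\<close>

definition plant_gamma :: "ratfun \<Rightarrow> ereal" where
  "plant_gamma P =
     Inf {ereal r | r. r > 0 \<and> (is_zero_of P (of_real r) \<or> is_pole_of P (of_real r))}"

definition plant_class :: "ereal \<Rightarrow> complex set \<Rightarrow> complex set \<Rightarrow> ratfun set" where
  "plant_class \<gamma> Z Q =
     {P. plant P \<and> plant_gamma P = \<gamma> \<and>
         {s. ereal (Re s) \<ge> \<gamma> \<and> is_zero_of P s} = Z \<and>
         {s. ereal (Re s) \<ge> \<gamma> \<and> is_pole_of P s} = Q}"

text \<open>
  Members of one class are compared under two provisos, without which their optimal values can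
  differ.

  First, both sets of error signals must be nonempty, so that the infima are taken over actual
  signals. The set is empty for a plant with a right half-plane zero at a pole of \<open>W\<close>; a
  non-real zero with real part below \<open>\<gamma>\<close> may be absent from another plant of the class.

  Secondly, if \<open>w 0 < 0\<close>, a biproper plant (\<open>zero_at_infinity P 0\<close>) is not compared with a
  strictly proper one in \<open>OS_opt\<close>: strict properness forces \<open>e 0 = w 0\<close>, biproperness does not.
  For \<open>w = -1\<close>, \<open>W = -1/s\<close>, the plants \<open>1\<close> and \<open>1/(s+1)\<close> have no poles or zeros in the closed
  right half-plane, but \<open>OS_opt\<close> is \<open>0\<close> for the first (\<open>e = 0\<close> is achievable) and at least \<open>1\<close>
  for the second. For \<open>w 0 \<ge> 0\<close>, in particular for non-negative \<open>w\<close>, this proviso is void.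
\<close>

end

theory Submission
  imports Defs "HOL-Complex_Analysis.Complex_Analysis"
begin

text \<open>
  An achievable error signal is \<open>e\<close> with transform \<open>W S\<close>, where the sensitivity \<open>S = d (v - q n)\<close>
  is stable, vanishes at the unstable poles of \<open>P\<close> and equals \<open>1\<close> at its unstable zeros and, to the
  order of \<open>P\<close>, at infinity. Two plants of one class impose the same conditions on \<open>Re s \<ge> \<gamma>\<close>. They
  differ in conditions at points with \<open>0 < Re s < \<gamma>\<close>, all of which are non-real because \<open>\<gamma>\<close> is the
  smallest real pole or zero, and in conditions at infinity, which concern derivatives of \<open>e\<close> at time
  zero. Neither difference costs anything. Given \<open>e\<close> achievable for \<open>P\<close>, any \<open>e\<^sub>0\<close> achievable for
  \<open>P'\<close> and \<open>\<epsilon> > 0\<close>, there is \<open>h\<close> such that \<open>e + h\<close> is achievable for \<open>P'\<close> and \<open>h \<ge> - \<epsilon>\<close>, apart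
  from a brief transient if the initial value of \<open>e\<close> has to be moved down; the same holds for \<open>e - h\<close>,
  with a transient if the initial value has to be moved up. These transients are harmless, because the
  first leads down to \<open>w 0 \<ge> 0\<close> and the second up to \<open>w 0\<close>. So the first signal bounds the optimal
  overshoot for \<open>P'\<close> by that for \<open>P\<close>, and the second the optimal undershoot
  (\<open>transfer_error_signal\<close>); exchanging the plants gives equality.

  The signal \<open>h\<close> is sought among the polynomials in \<open>exp (- t)\<close>. It must have the transform values of
  \<open>e\<^sub>0 - e\<close> at the poles and zeros of \<open>P'\<close> and agree with \<open>e\<^sub>0 - e\<close> to a given order at infinity.
  The order at infinity is a condition on finitely many derivatives at time zero, and the polynomials
  that satisfy it are still uniformly dense among the signals with the right initial value
  (\<open>poly_exp_dense\<close>). For the transform values, suppose that no admissible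
  \<open>h\<close> attains them. Then a functional separates them from the convex set of attained values
  (\<open>convex_contains_zero\<close>). This functional is integration against a sum \<open>\<phi>\<close> of exponentials
  \<open>exp (- s t)\<close>, with \<open>s\<close> among the prescribed points. As \<open>h\<close> may be large and positive, \<open>\<phi> \<le> 0\<close>. A
  sum of exponentials of constant sign has a real slowest mode (\<open>slowest_mode_real\<close>), so \<open>\<phi>\<close> involves
  only points with \<open>Re s \<ge> \<gamma>\<close>. But there the prescribed values are zero, and hence so is the bound
  provided by the functional; as \<open>h\<close> may also be slightly negative, \<open>\<phi> = 0\<close>
  (\<open>one_sided_interpolation\<close>).

  That a signal tending to zero has a transform without poles on the closed right half-plane
  (\<open>C0_laplace_no_poles\<close>) makes the transform of \<open>e\<^sub>0 - e\<close> stable. The conditions at finite points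
  and at infinity are all statements about valuations, and are treated uniformly.
\<close>

section \<open>Valuations of real-rational functions\<close>

text \<open>
  The order at a point \<open>s\<close> and minus the degree are both valuations of polynomials. Their extensions
  to rational functions measure the zeros and poles at \<open>s\<close> and at infinity.
\<close>

locale poly_valuation =
  fixes f :: "real poly \<Rightarrow> int"
  assumes f_mult: "a \<noteq> 0 \<Longrightarrow> b \<noteq> 0 \<Longrightarrow> f (a * b) = f a + f b"
    and f_add: "a \<noteq> 0 \<Longrightarrow> b \<noteq> 0 \<Longrightarrow> a + b \<noteq> 0 \<Longrightarrow> min (f a) (f b) \<le> f (a + b)"

lemma Fract_rnum_rden: "Fract (rnum F) (rden F) = F"
  using quot_to_fract_quot_of_fract[of F]
  by (simp add: rnum_def rden_def quot_to_fract_def case_prod_unfold)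

lemma rden_nonzero [simp]: "rden F \<noteq> 0"
proof -
  have "quot_of_fract F \<in> normalized_fracts" by simp
  then show ?thesis unfolding rden_def by (cases "quot_of_fract F") auto
qed

lemma coprime_rnum_rden: "coprime (rnum F) (rden F)"
proof -
  have "quot_of_fract F \<in> normalized_fracts" by simp
  then show ?thesis unfolding rden_def rnum_def normalized_fracts_def
    by (cases "quot_of_fract F") auto
qed

lemma rnum_0 [simp]: "rnum 0 = 0" and rden_0 [simp]: "rden 0 = 1"
  by (simp_all add: rnum_def rden_def)

lemma rnum_eq_0_iff [simp]: "rnum F = 0 \<longleftrightarrow> F = 0"
proof
  assume "rnum F = 0"
  then have "F = Fract 0 (rden F)" using Fract_rnum_rden[of F] by simp
  then show "F = 0" by (simp add: fract_collapse)
qed simp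

lemma rnum_rden_Fract:
  assumes "b \<noteq> 0"
  obtains d where "a = rnum (Fract a b) * d" "b = rden (Fract a b) * d" "d \<noteq> 0"
proof -
  have "quot_of_fract (Fract a b) = normalize_quot (a, b)"
    using quot_of_fract_quot_to_fract[of "(a,b)"] by (simp add: quot_to_fract_def)
  then show ?thesis using normalize_quotE[OF assms, of a] that
    by (metis rden_def rnum_def)
qed

context poly_valuation
begin

definition val :: "ratfun \<Rightarrow> int" where
  "val F = f (rnum F) - f (rden F)"

text \<open>The zero function has infinite valuation.\<close>

definition ge :: "int \<Rightarrow> ratfun \<Rightarrow> bool" where
  "ge k F \<longleftrightarrow> F = 0 \<or> k \<le> val F"

lemma val_Fract:
  assumes "a \<noteq> 0" "b \<noteq> 0"
  shows "val (Fract a b) = f a - f b"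
proof -
  obtain d where d: "a = rnum (Fract a b) * d" "b = rden (Fract a b) * d" "d \<noteq> 0"
    using rnum_rden_Fract[OF assms(2)] .
  have "rnum (Fract a b) \<noteq> 0" using d(1) assms(1) by (metis mult_zero_left)
  then have "f a = f (rnum (Fract a b)) + f d" "f b = f (rden (Fract a b)) + f d"
    using f_mult d rden_nonzero by metis+
  then show ?thesis by (simp add: val_def)
qed

lemma ratfun_cases:
  fixes F :: ratfun
  obtains a b where "F = Fract a b" "b \<noteq> 0" "F \<noteq> 0 \<longrightarrow> a \<noteq> 0"
  using Fract_rnum_rden[of F] rden_nonzero[of F] rnum_eq_0_iff[of F] by metis

lemma val_mult:
  assumes "F \<noteq> 0" "G \<noteq> 0"
  shows "val (F * G) = val F + val G"
proof -
  obtain a b where F: "F = Fract a b" "b \<noteq> 0" "a \<noteq> 0" using ratfun_cases[of F] assms by metis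
  obtain c d where G: "G = Fract c d" "d \<noteq> 0" "c \<noteq> 0" using ratfun_cases[of G] assms by metis
  show ?thesis using F G by (simp add: val_Fract f_mult)
qed

lemma val_1 [simp]: "val 1 = 0"
  using val_mult[of 1 1] by simp

lemma val_divide:
  assumes "F \<noteq> 0" "G \<noteq> 0"
  shows "val (F / G) = val F - val G"
  using val_mult[of "F / G" G] assms by simp

lemma val_uminus [simp]: "val (- F) = val F"
proof (cases "F = 0")
  case False
  have "val (-1) + val (-1) = 0" using val_mult[of "-1" "-1"] by simp
  then show ?thesis using val_mult[of "-1" F] False by simp
qed simp

lemma ge_0 [simp]: "ge k 0"
  by (simp add: ge_def)

lemma ge_mono: "ge k F \<Longrightarrow> l \<le> k \<Longrightarrow> ge l F"
  by (auto simp: ge_def)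

lemma ge_mult:
  assumes "ge k F" "ge l G"
  shows "ge (k + l) (F * G)"
proof (cases "F = 0 \<or> G = 0")
  case False
  then show ?thesis using assms val_mult[of F G] by (simp add: ge_def)
qed auto

lemma ge_uminus [simp]: "ge k (- F) \<longleftrightarrow> ge k F"
  by (auto simp: ge_def)

lemma ge_add:
  assumes "ge k F" "ge k G"
  shows "ge k (F + G)"
proof (cases "F = 0 \<or> G = 0 \<or> F + G = 0")
  case True
  then show ?thesis using assms by (auto simp: ge_def)
next
  case False
  obtain a b where F: "F = Fract a b" "b \<noteq> 0" "a \<noteq> 0" using ratfun_cases[of F] False by metis
  obtain c d where G: "G = Fract c d" "d \<noteq> 0" "c \<noteq> 0" using ratfun_cases[of G] False by metis
  have sum: "F + G = Fract (a * d + c * b) (b * d)" using F G by simp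
  have nz: "a * d + c * b \<noteq> 0" using False sum F(2) G(2) by (metis fract_collapse(1))
  have "min (f (a * d)) (f (c * b)) \<le> f (a * d + c * b)"
    using f_add F G nz by simp
  moreover have "k \<le> f a - f b" "k \<le> f c - f d"
    using assms False val_Fract[OF F(3,2)] val_Fract[OF G(3,2)] F(1) G(1) by (auto simp: ge_def)
  moreover have "val (F + G) = f (a * d + c * b) - f (b * d)"
    unfolding sum using nz F G by (intro val_Fract) auto
  ultimately show ?thesis using F G
    by (simp add: ge_def f_mult min_def split: if_splits)
qed

lemma ge_diff:
  assumes "ge k F" "ge k G"
  shows "ge k (F - G)"
  using ge_add[of k F "- G"] assms by simp

lemma ge_sum:
  assumes "\<And>i. i \<in> I \<Longrightarrow> ge k (F i)"
  shows "ge k (\<Sum>i\<in>I. F i)"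
  using assms by (induction I rule: infinite_finite_induct) (auto intro: ge_add)

text \<open>
  If both \<open>n\<close> and \<open>d\<close> had positive valuation, so would \<open>1 = x n + v d\<close>. Hence at each place one
  of the two is a unit, and the other carries the whole valuation of the quotient.
\<close>

lemma val_bezout:
  assumes "ge 0 n" "ge 0 d" "ge 0 x" "ge 0 v" "x * n + v * d = 1" "n \<noteq> 0" "d \<noteq> 0"
  shows "val n = max 0 (val (n / d))" "val d = max 0 (- val (n / d))"
proof -
  have "\<not> (ge 1 n \<and> ge 1 d)"
  proof
    assume "ge 1 n \<and> ge 1 d"
    then have "ge (0 + 1) (x * n + v * d)" using assms by (intro ge_add ge_mult) auto
    then show False using assms(5) by (simp add: ge_def)
  qed
  then show "val n = max 0 (val (n / d))" "val d = max 0 (- val (n / d))"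
    using assms by (auto simp: ge_def val_divide)
qed

end

lemma cpoly_mult: "cpoly (p * q) = cpoly p * cpoly q"
  by (rule poly_eqI) (simp add: coeff_map_poly coeff_mult)

lemma cpoly_add: "cpoly (p + q) = cpoly p + cpoly q"
  by (rule poly_eqI) (simp add: coeff_map_poly)

lemma cpoly_eq_0_iff [simp]: "cpoly p = 0 \<longleftrightarrow> p = 0"
  by (simp add: map_poly_eq_0_iff)

abbreviation ord_at :: "complex \<Rightarrow> real poly \<Rightarrow> int" where
  "ord_at s p \<equiv> int (order s (cpoly p))"

interpretation at: poly_valuation "ord_at s" for s
proof
  fix a b :: "real poly"
  assume ab: "a \<noteq> 0" "b \<noteq> 0"
  show "ord_at s (a * b) = ord_at s a + ord_at s b"
    using ab by (simp add: cpoly_mult order_mult)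
  assume "a + b \<noteq> 0"
  let ?k = "min (order s (cpoly a)) (order s (cpoly b))"
  have "[:-s, 1:] ^ ?k dvd cpoly a" "[:-s, 1:] ^ ?k dvd cpoly b"
    using ab by (simp_all add: order_divides)
  then have "[:-s, 1:] ^ ?k dvd cpoly (a + b)" by (simp add: cpoly_add)
  then show "min (ord_at s a) (ord_at s b) \<le> ord_at s (a + b)"
    using \<open>a + b \<noteq> 0\<close> by (auto simp: order_divides min_def split: if_splits)
qed

interpretation inf: poly_valuation "\<lambda>p. - int (degree p)"
proof
  fix a b :: "real poly"
  assume ab: "a \<noteq> 0" "b \<noteq> 0"
  show "- int (degree (a * b)) = - int (degree a) + - int (degree b)"
    using ab by (simp add: degree_mult_eq)
  show "min (- int (degree a)) (- int (degree b)) \<le> - int (degree (a + b))"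
    using degree_add_le_max[of a b] by linarith
qed

text \<open>
  Coprimality over the reals is witnessed by a Bezout identity, which persists at complex points.
\<close>

lemma no_common_zero:
  "\<not> (poly (cpoly (rnum F)) s = 0 \<and> poly (cpoly (rden F)) s = 0)"
proof
  assume z: "poly (cpoly (rnum F)) s = 0 \<and> poly (cpoly (rden F)) s = 0"
  obtain u v where "u * rnum F + v * rden F = 1"
    using coprime_rnum_rden[of F] bezout_coefficients_fst_snd[of "rnum F" "rden F"]
    by (metis coprime_iff_gcd_eq_1)
  then have "poly (cpoly (u * rnum F + v * rden F)) s = 1" by simp
  then show False using z by (simp add: cpoly_add cpoly_mult)
qed

lemma order_cpoly_pos_iff:
  "p \<noteq> 0 \<Longrightarrow> 0 < order s (cpoly p) \<longleftrightarrow> poly (cpoly p) s = 0"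
  by (simp add: order_gt_0_iff)

lemma not_pole_iff: "\<not> is_pole_of F s \<longleftrightarrow> at.ge s 0 F"
proof (cases "F = 0")
  case False
  then show ?thesis
    using no_common_zero[of F s] order_cpoly_pos_iff[of "rnum F" s] order_cpoly_pos_iff[of "rden F" s]
    unfolding is_pole_of_def at.ge_def at.val_def by auto
qed (simp add: is_pole_of_def at.ge_def)

lemma zero_iff: "is_zero_of F s \<longleftrightarrow> at.ge s 1 F"
proof (cases "F = 0")
  case False
  then show ?thesis
    using no_common_zero[of F s] order_cpoly_pos_iff[of "rnum F" s] order_cpoly_pos_iff[of "rden F" s]
    unfolding is_zero_of_def at.ge_def at.val_def by auto
qed (simp add: is_zero_of_def at.ge_def)

lemma proper_iff: "proper F \<longleftrightarrow> inf.ge 0 F"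
  by (auto simp: proper_def inf.ge_def inf.val_def)

lemma stable_iff: "F \<in> stable_ratfuns \<longleftrightarrow> inf.ge 0 F \<and> (\<forall>s. Re s \<ge> 0 \<longrightarrow> at.ge s 0 F)"
  by (simp add: stable_ratfuns_def proper_iff not_pole_iff)

lemma zero_at_infinity_iff: "zero_at_infinity F k \<longleftrightarrow> F \<noteq> 0 \<and> inf.val F = int k"
  by (auto simp: zero_at_infinity_def inf.val_def)

lemma rat_eval_Fract:
  assumes "poly (cpoly b) s \<noteq> 0"
  shows "rat_eval (Fract a b) s = poly (cpoly a) s / poly (cpoly b) s"
    and "at.ge s 0 (Fract a b)"
proof -
  have "b \<noteq> 0" using assms by auto
  then obtain d where d: "a = rnum (Fract a b) * d" "b = rden (Fract a b) * d" "d \<noteq> 0"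
    using rnum_rden_Fract by metis
  have e: "poly (cpoly a) s = poly (cpoly (rnum (Fract a b))) s * poly (cpoly d) s"
       "poly (cpoly b) s = poly (cpoly (rden (Fract a b))) s * poly (cpoly d) s"
    using d by (metis cpoly_mult poly_mult)+
  then show "rat_eval (Fract a b) s = poly (cpoly a) s / poly (cpoly b) s"
    using assms by (auto simp: rat_eval_def)
  show "at.ge s 0 (Fract a b)" using e assms by (auto simp: not_pole_iff[symmetric] is_pole_of_def)
qed

lemma rden_regular: "at.ge s 0 F \<Longrightarrow> poly (cpoly (rden F)) s \<noteq> 0"
  using not_pole_iff[of F s] by (simp add: is_pole_of_def)

lemma rat_eval_add:
  assumes "at.ge s 0 F" "at.ge s 0 G"
  shows "rat_eval (F + G) s = rat_eval F s + rat_eval G s"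
proof -
  have sum: "F + G = Fract (rnum F * rden G + rnum G * rden F) (rden F * rden G)"
    by (metis Fract_rnum_rden add_fract rden_nonzero)
  have nz: "poly (cpoly (rden F)) s \<noteq> 0" "poly (cpoly (rden G)) s \<noteq> 0"
    using rden_regular assms by auto
  have "poly (cpoly (rden F * rden G)) s \<noteq> 0" using nz by (simp add: cpoly_mult)
  then show ?thesis unfolding sum
    using nz by (subst rat_eval_Fract(1))
      (simp_all add: cpoly_mult cpoly_add rat_eval_def add_frac_eq)
qed

lemma rat_eval_mult:
  assumes "at.ge s 0 F" "at.ge s 0 G"
  shows "rat_eval (F * G) s = rat_eval F s * rat_eval G s"
proof -
  have prod: "F * G = Fract (rnum F * rnum G) (rden F * rden G)"
    by (metis Fract_rnum_rden mult_fract)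
  have nz: "poly (cpoly (rden F)) s \<noteq> 0" "poly (cpoly (rden G)) s \<noteq> 0"
    using rden_regular assms by auto
  have "poly (cpoly (rden F * rden G)) s \<noteq> 0" using nz by (simp add: cpoly_mult)
  then show ?thesis unfolding prod
    by (subst rat_eval_Fract(1)) (simp_all add: cpoly_mult rat_eval_def)
qed

lemma rat_eval_uminus: "at.ge s 0 F \<Longrightarrow> rat_eval (- F) s = - rat_eval F s"
  using rat_eval_add[of s F "- F"] by (simp add: rat_eval_def eq_neg_iff_add_eq_0 add.commute)

lemma rat_eval_diff:
  "at.ge s 0 F \<Longrightarrow> at.ge s 0 G \<Longrightarrow> rat_eval (F - G) s = rat_eval F s - rat_eval G s"
  using rat_eval_add[of s F "- G"] rat_eval_uminus[of s G] by simp

lemma rat_eval_eq_0_iff: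
  assumes "at.ge s 0 F"
  shows "rat_eval F s = 0 \<longleftrightarrow> at.ge s 1 F"
  using rden_regular[OF assms] zero_iff[of F s] by (simp add: rat_eval_def is_zero_of_def)

lemma rat_eval_cnj: "rat_eval F (cnj s) = cnj (rat_eval F s)"
proof -
  have "map_poly cnj (cpoly p) = cpoly p" for p
    by (simp add: map_poly_map_poly o_def)
  then show ?thesis by (simp add: rat_eval_def) (metis poly_cnj complex_cnj_divide)
qed

lemma eventually_regular: "\<exists>a. \<forall>s. Re s > a \<longrightarrow> at.ge s 0 F"
proof -
  have "finite {s. poly (cpoly (rden F)) s = 0}"
    by (rule poly_roots_finite) simp
  then have fin: "finite (Re ` {s. poly (cpoly (rden F)) s = 0})" by simp
  then obtain a where "\<forall>x \<in> Re ` {s. poly (cpoly (rden F)) s = 0}. x \<le> a"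
    by (metis bdd_above_finite bdd_above_def)
  then show ?thesis
    by (intro exI[of _ a]) (force simp: not_pole_iff[symmetric] is_pole_of_def)
qed

section \<open>Laplace integrals\<close>

abbreviation half_line :: "real measure" where
  "half_line \<equiv> restrict_space lborel {0..}"

lemma set_integral_half_line:
  fixes f :: "real \<Rightarrow> 'a::{banach, second_countable_topology}"
  shows "set_integrable lborel {0..} f \<longleftrightarrow> integrable half_line f"
    and "set_lebesgue_integral lborel {0..} f = integral\<^sup>L half_line f"
  by (simp_all add: set_integrable_eq set_lebesgue_integral_def integral_restrict_space)

lemma continuous_measurable_half_line:
  fixes f :: "real \<Rightarrow> 'a::euclidean_space"
  assumes "continuous_on {0..} f"
  shows "f \<in> borel_measurable half_line"
  using borel_measurable_continuous_on_restrict[OF assms]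
  by (simp add: measurable_def sets_restrict_space space_restrict_space)

lemma integrable_half_line_exp:
  assumes "0 < a"
  shows "integrable half_line (\<lambda>t. exp (- (a * t)))"
    and "(\<integral>t. exp (- (a * t)) \<partial>half_line) = 1 / a"
proof -
  let ?f = "\<lambda>t::real. exp (- (a * t))"
  have I: "(?f has_integral 1 / a) {0..}"
    using has_integral_exp_minus_to_infinity[OF assms, of 0] by simp
  then have "?f absolutely_integrable_on {0..}"
    by (intro nonnegative_absolutely_integrable_1) auto
  moreover have "(\<lambda>t. indicator {0..} t *\<^sub>R ?f t) \<in> borel_measurable lborel"
    by (simp add: borel_measurable_continuous_on_indicator continuous_intros)
  ultimately have S: "set_integrable lborel {0..} ?f"
    unfolding set_integrable_def using integrable_completion by blast
  then show "integrable half_line ?f" by (simp add: set_integral_half_line)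
  show "(\<integral>t. ?f t \<partial>half_line) = 1 / a"
    using set_borel_integral_eq_integral(2)[OF S] I by (simp add: set_integral_half_line integral_unique)
qed

lemma integrable_half_line_bound:
  fixes f :: "real \<Rightarrow> 'a::euclidean_space"
  assumes "f \<in> borel_measurable half_line" "0 < a"
    and "\<And>t. 0 \<le> t \<Longrightarrow> norm (f t) \<le> C * exp (- (a * t))"
  shows "integrable half_line f" and "norm (integral\<^sup>L half_line f) \<le> C / a"
proof -
  have I: "integrable half_line (\<lambda>t. C * exp (- (a * t)))"
    using integrable_half_line_exp(1)[OF assms(2)] by simp
  show f: "integrable half_line f"
    by (rule Bochner_Integration.integrable_bound[OF I assms(1)])
      (auto intro!: AE_I2 order_trans[OF assms(3)] simp: space_restrict_space)
  have "norm (integral\<^sup>L half_line f) \<le> (\<integral>t. C * exp (- (a * t)) \<partial>half_line)"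
    using f I assms(3) by (intro Bochner_Integration.integral_norm_bound_integral)
      (auto simp: space_restrict_space)
  then show "norm (integral\<^sup>L half_line f) \<le> C / a"
    using integrable_half_line_exp(2)[OF assms(2)] by simp
qed

definition laplace :: "(real \<Rightarrow> complex) \<Rightarrow> complex \<Rightarrow> complex" where
  "laplace f z = (\<integral>t. exp (- z * of_real t) * f t \<partial>half_line)"

lemma has_laplace_iff:
  "has_laplace f F \<longleftrightarrow> (\<exists>a. \<forall>s. Re s > a \<longrightarrow>
     integrable half_line (\<lambda>t. exp (- s * of_real t) * complex_of_real (f t)) \<and>
     laplace (\<lambda>t. of_real (f t)) s = rat_eval F s)"
  unfolding has_laplace_def set_integral_half_line laplace_def ..

lemma laplace_integrable:
  assumes "continuous_on {0..} f" "\<And>t. 0 \<le> t \<Longrightarrow> norm (f t) \<le> C" "0 < Re z"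
  shows "integrable half_line (\<lambda>t. exp (- z * of_real t) * f t)"
proof (rule integrable_half_line_bound(1)[where a = "Re z" and C = C])
  show "(\<lambda>t. exp (- z * of_real t) * f t) \<in> borel_measurable half_line"
    using assms(1) by (intro continuous_measurable_half_line continuous_intros)
  show "norm (exp (- z * of_real t) * f t) \<le> C * exp (- (Re z * t))" if "0 \<le> t" for t
    using assms(2)[OF that] by (simp add: norm_mult mult.commute mult_right_mono)
qed (use assms in auto)

lemma laplace_exp:
  assumes "0 < Re z"
  shows "integrable half_line (\<lambda>t. exp (- z * of_real t))"
    and "(\<integral>t. exp (- z * of_real t) \<partial>half_line) = 1 / z"
proof -
  show I: "integrable half_line (\<lambda>t. exp (- z * of_real t))"
    using laplace_integrable[of "\<lambda>_. 1" 1 z] assms by (simp add: continuous_intros)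
  have z: "z \<noteq> 0" using assms by auto
  have "set_integrable lborel {0..} (\<lambda>t. exp (- z * of_real t))"
    using I by (simp add: set_integral_half_line)
  then have L: "((\<lambda>b. LINT t:{0..b}|lborel. exp (- z * of_real t)) \<longlongrightarrow>
      (\<integral>t. exp (- z * of_real t) \<partial>half_line)) at_top"
    unfolding set_integral_half_line(2)[symmetric]
    by (intro tendsto_set_lebesgue_integral_at_top) auto
  have "(LINT t:{0..b}|lborel. exp (- z * of_real t)) = (1 - exp (- z * of_real b)) / z"
    if "b \<ge> 0" for b :: real
  proof -
    have "((\<lambda>t. exp (- z * of_real t)) has_integral
        (- exp (- z * of_real b) / z - - exp (- z * of_real 0) / z)) {0..b}"
      using that z
      by (intro fundamental_theorem_of_calculus)
        (auto intro!: derivative_eq_intros has_vector_derivative_real_field)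
    then show ?thesis
      by (subst set_borel_integral_eq_integral(2))
        (auto intro!: borel_integrable_atLeastAtMost' continuous_intros
          simp: integral_unique diff_divide_distrib)
  qed
  then have L': "((\<lambda>b. (1 - exp (- z * of_real b)) / z) \<longlongrightarrow>
      (\<integral>t. exp (- z * of_real t) \<partial>half_line)) at_top"
    using L by (rule_tac Lim_transform_eventually)
      (auto intro!: eventually_mono[OF eventually_ge_at_top[of 0]])
  have "((\<lambda>b. exp (- z * of_real b)) \<longlongrightarrow> 0) at_top"
  proof (rule tendsto_norm_zero_cancel)
    have "((\<lambda>b. exp (- (Re z * b))) \<longlongrightarrow> 0) at_top"
      using assms by (intro filterlim_compose[OF exp_at_bot]) 
        (auto intro!: filterlim_tendsto_pos_mult_at_top[OF tendsto_const] filterlim_ident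
          simp: filterlim_uminus_at_bot)
    then show "((\<lambda>b. norm (exp (- z * of_real b))) \<longlongrightarrow> 0) at_top" by simp
  qed
  then have lim: "((\<lambda>b. (1 - exp (- z * of_real b)) / z) \<longlongrightarrow> (1 - 0) / z) at_top"
    using z by (intro tendsto_intros)
  show "(\<integral>t. exp (- z * of_real t) \<partial>half_line) = 1 / z"
    using tendsto_unique[OF _ L' lim] by simp
qed

text \<open>
  Half of the decay rate makes the tail small, the other half keeps it integrable. The bound depends
  on \<open>z\<close> only through a lower bound of its real part, so it gives locally uniform convergence of the
  truncated transforms.
\<close>

lemma laplace_truncation:
  assumes f: "continuous_on {0..} f" and C: "\<And>t. 0 \<le> t \<Longrightarrow> norm (f t) \<le> C"
    and a: "0 < a" "a \<le> Re z" and T: "0 \<le> T"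
  shows "norm (laplace f z - integral {0..T} (\<lambda>t. exp (- z * of_real t) * f t))
    \<le> 2 * C * exp (- (a / 2 * T)) / a"
proof -
  let ?g = "\<lambda>t. exp (- z * of_real t) * f t"
  let ?h = "\<lambda>t. indicator {T<..} t *\<^sub>R ?g t"
  have g: "integrable half_line ?g" using laplace_integrable[OF f C, of z] a by simp
  have C0: "0 \<le> C" using C[of 0] norm_ge_zero[of "f 0"] by linarith
  have gc: "continuous_on {0..} ?g" using f by (intro continuous_intros)
  have gm: "?g \<in> borel_measurable half_line" by (rule continuous_measurable_half_line[OF gc])
  have ind: "indicator S \<in> borel_measurable half_line" if "S \<in> sets borel" for S :: "real set"
    using that by (intro measurable_restrict_space1 borel_measurable_indicator) simp
  have b: "norm (?h t) \<le> (C * exp (- (a / 2 * T))) * exp (- (a / 2 * t))" if "0 \<le> t" for t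
  proof (cases "T < t")
    case True
    have "a * t \<le> Re z * t" using a that by (intro mult_right_mono) auto
    moreover have "a / 2 * T \<le> a / 2 * t" using True a by (intro mult_left_mono) auto
    ultimately have "- (Re z * t) \<le> - (a / 2 * T) + - (a / 2 * t)" by (simp add: field_simps)
    then have "exp (- (Re z * t)) \<le> exp (- (a / 2 * T)) * exp (- (a / 2 * t))"
      by (simp add: exp_add[symmetric])
    then have "exp (- (Re z * t)) * norm (f t) \<le> (exp (- (a / 2 * T)) * exp (- (a / 2 * t))) * C"
      using C[OF that] by (intro mult_mono) auto
    then show ?thesis using True by (simp add: norm_mult mult_ac)
  qed (use C0 in auto)
  have hm: "?h \<in> borel_measurable half_line"
    using gm ind[of "{T<..}"] by (intro borel_measurable_scaleR) auto
  have h: "integrable half_line ?h" "norm (integral\<^sup>L half_line ?h) \<le> C * exp (- (a / 2 * T)) / (a / 2)"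
    using integrable_half_line_bound[OF hm _ b] a by auto
  have gT: "set_integrable lborel {0..T} ?g"
    using gc by (intro borel_integrable_atLeastAtMost') (auto elim: continuous_on_subset)
  have "laplace f z = (\<integral>t. indicator {0..T} t *\<^sub>R ?g t + ?h t \<partial>half_line)"
    unfolding laplace_def by (intro Bochner_Integration.integral_cong refl)
      (auto simp: indicator_def space_restrict_space)
  also have "\<dots> = (\<integral>t. indicator {0..T} t *\<^sub>R ?g t \<partial>half_line) + integral\<^sup>L half_line ?h"
  proof (rule Bochner_Integration.integral_add[OF _ h(1)])
    show "integrable half_line (\<lambda>t. indicator {0..T} t *\<^sub>R ?g t)"
    proof (rule Bochner_Integration.integrable_bound[OF g])
      show "(\<lambda>t. indicator {0..T} t *\<^sub>R ?g t) \<in> borel_measurable half_line"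
        using gm ind[of "{0..T}"] by (intro borel_measurable_scaleR) auto
    qed (auto intro!: AE_I2 simp: indicator_def)
  qed
  also have "(\<integral>t. indicator {0..T} t *\<^sub>R ?g t \<partial>half_line) = (LINT t:{0..T}|lborel. ?g t)"
    unfolding set_integral_half_line(2)[symmetric] set_lebesgue_integral_def
    by (intro Bochner_Integration.integral_cong refl) (auto simp: indicator_def)
  also have "\<dots> = integral {0..T} ?g"
    by (rule set_borel_integral_eq_integral(2)[OF gT])
  finally show ?thesis using h(2) by (simp add: mult_ac)
qed

lemma holomorphic_laplace:
  assumes f: "continuous_on {0..} f" and C: "\<And>t. 0 \<le> t \<Longrightarrow> norm (f t) \<le> C"
  shows "laplace f holomorphic_on {z. 0 < Re z}"
proof (rule holomorphic_uniform_sequence)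
  let ?U = "{z::complex. 0 < Re z}"
  let ?F = "\<lambda>n z. integral {0..real n} (\<lambda>t. exp (- z * of_real t) * f t)"
  show "open ?U" by (rule open_halfspace_Re_gt)
  show "?F n holomorphic_on ?U" for n
    unfolding cbox_interval[symmetric]
  proof (rule leibniz_rule_holomorphic)
    have fc: "continuous_on (cbox 0 (real n)) f" using f by (rule continuous_on_subset) auto
    show "((\<lambda>z. exp (- z * of_real t) * f t) has_field_derivative
        exp (- z * of_real t) * (- of_real t) * f t) (at z within ?U)" for z t
      by (auto intro!: derivative_eq_intros)
    show "(\<lambda>t. exp (- z * of_real t) * f t) integrable_on cbox 0 (real n)" for z
      using fc by (intro integrable_continuous continuous_intros)
    have "continuous_on (?U \<times> cbox 0 (real n)) (\<lambda>x. f (snd x))"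
      by (rule continuous_on_compose2[OF fc]) (auto intro: continuous_intros)
    then show "continuous_on (?U \<times> cbox 0 (real n))
        (\<lambda>(z, t). exp (- z * of_real t) * (- of_real t) * f t)"
      by (auto simp: case_prod_unfold intro!: continuous_intros)
    show "convex ?U" by (rule convex_halfspace_Re_gt)
  qed
  fix z :: complex assume "z \<in> ?U"
  then have z: "0 < Re z" by simp
  define d where "d = Re z / 2"
  have d: "0 < d" using z by (simp add: d_def)
  have Re: "d \<le> Re x" if "x \<in> cball z d" for x
    using that abs_Re_le_cmod[of "z - x"] by (auto simp: d_def dist_norm)
  have lim: "(\<lambda>n. 2 * C * exp (- (d / 2 * real n)) / d) \<longlonglongrightarrow> 0"
    using d by real_asymp
  have "uniform_limit (cball z d) ?F (laplace f) sequentially"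
  proof (rule uniform_limitI)
    fix e :: real assume "0 < e"
    have "eventually (\<lambda>n. 2 * C * exp (- (d / 2 * real n)) / d < e) sequentially"
      using order_tendstoD(2)[OF lim \<open>0 < e\<close>] .
    then show "\<forall>\<^sub>F n in sequentially. \<forall>x\<in>cball z d. dist (?F n x) (laplace f x) < e"
    proof eventually_elim
      case (elim n)
      show ?case
      proof
        fix x assume "x \<in> cball z d"
        then show "dist (?F n x) (laplace f x) < e"
          using laplace_truncation[OF f C d Re, of x "real n"] elim
          by (simp add: dist_norm norm_minus_commute)
      qed
    qed
  qed
  moreover have "cball z d \<subseteq> ?U" using Re d by force
  ultimately show "\<exists>d>0. cball z d \<subseteq> ?U \<and> uniform_limit (cball z d) ?F (laplace f) sequentially"
    using d by blast
qed

text \<open>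
  A signal tending to zero has transform \<open>o(1 / \<sigma>)\<close> at distance \<open>\<sigma>\<close> from the imaginary axis,
  whereas a pole there would force growth at least of order \<open>1 / \<sigma>\<close>.
\<close>

lemma laplace_near_imaginary_axis:
  assumes f: "continuous_on {0..} f" and lim: "(f \<longlongrightarrow> 0) at_top"
    and C: "\<And>t. 0 \<le> t \<Longrightarrow> norm (f t) \<le> C" and s: "Re s = 0"
  shows "((\<lambda>x. of_real x * laplace f (s + of_real x)) \<longlongrightarrow> 0) (at_right 0)"
proof (rule tendstoI)
  fix e :: real assume e: "0 < e"
  have C0: "0 \<le> C" using C[of 0] norm_ge_zero[of "f 0"] by linarith
  obtain T where T: "\<And>t. T \<le> t \<Longrightarrow> norm (f t) < e / 2"
    using tendstoD[OF lim, of "e / 2"] e by (auto simp: eventually_at_top_linorder)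
  have bound: "norm (of_real x * laplace f (s + of_real x)) \<le> e / 2 + x * (C * exp T)"
    if x: "0 < x" for x :: real
  proof -
    have I: "integrable half_line (\<lambda>t. exp (- (s + of_real x) * of_real t) * f t)"
      using laplace_integrable[OF f C, of "s + of_real x"] s x by simp
    have J: "integrable half_line (\<lambda>t. e / 2 * exp (- (x * t)) + C * exp T * exp (- ((1 + x) * t)))"
      using x by (intro Bochner_Integration.integrable_add integrable_mult_right integrable_half_line_exp) auto
    have "norm (laplace f (s + of_real x)) \<le>
        (\<integral>t. e / 2 * exp (- (x * t)) + C * exp T * exp (- ((1 + x) * t)) \<partial>half_line)"
      unfolding laplace_def
    proof (rule Bochner_Integration.integral_norm_bound_integral[OF I J])
      fix t :: real assume "t \<in> space half_line"
      then have t: "0 \<le> t" by (simp add: space_restrict_space)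
      have "norm (f t) \<le> e / 2 + C * exp (T - t)"
      proof (cases "T \<le> t")
        case True
        then show ?thesis using T[of t] C0 by (smt (verit) exp_ge_zero mult_nonneg_nonneg)
      next
        case False
        then have "1 \<le> exp (T - t)" by simp
        then have "C * 1 \<le> C * exp (T - t)" using C0 by (intro mult_left_mono)
        then show ?thesis using C[OF t] e by simp
      qed
      then have "exp (- (x * t)) * norm (f t) \<le> exp (- (x * t)) * (e / 2 + C * exp (T - t))"
        by (intro mult_left_mono) auto
      then show "norm (exp (- (s + of_real x) * of_real t) * f t)
          \<le> e / 2 * exp (- (x * t)) + C * exp T * exp (- ((1 + x) * t))"
        using s by (simp add: norm_mult norm_exp_eq_Re algebra_simps flip: exp_add)
    qed
    also have "\<dots> = e / 2 * (1 / x) + C * exp T * (1 / (1 + x))"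
      using x integrable_half_line_exp[of x] integrable_half_line_exp[of "1 + x"] by simp
    also have "\<dots> \<le> e / 2 * (1 / x) + C * exp T * 1"
      using x C0 by (intro add_left_mono mult_left_mono) auto
    finally have "x * norm (laplace f (s + of_real x)) \<le> x * (e / 2 * (1 / x) + C * exp T * 1)"
      using x by (intro mult_left_mono) auto
    then show ?thesis using x by (simp add: norm_mult algebra_simps)
  qed
  have "((\<lambda>x. e / 2 + x * (C * exp T)) \<longlongrightarrow> e / 2 + 0 * (C * exp T)) (at_right 0)"
    by (intro tendsto_intros)
  then have "eventually (\<lambda>x. e / 2 + x * (C * exp T) < e) (at_right 0)"
    using e order_tendstoD(2)[of _ "e / 2" "at_right 0" e] by simp
  then show "\<forall>\<^sub>F x in at_right 0. dist (of_real x * laplace f (s + of_real x)) 0 < e"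
    using eventually_at_right_less[of 0]
  proof eventually_elim
    case (elim x)
    then show ?case using bound[of x] by simp
  qed
qed

lemma C0_bounded:
  assumes "f \<in> C0"
  obtains C where "\<And>t. 0 \<le> t \<Longrightarrow> \<bar>f t\<bar> \<le> C"
proof -
  have f: "continuous_on {0..} f" "(f \<longlongrightarrow> 0) at_top" using assms by (auto simp: C0_def)
  obtain T where T: "\<And>t. T \<le> t \<Longrightarrow> \<bar>f t\<bar> < 1"
    using tendstoD[OF f(2), of 1] by (auto simp: eventually_at_top_linorder)
  have "compact (f ` {0..T})"
    using f(1) by (intro compact_continuous_image) (auto elim: continuous_on_subset)
  then obtain B where B: "\<And>t. 0 \<le> t \<Longrightarrow> t \<le> T \<Longrightarrow> \<bar>f t\<bar> \<le> B"
    using compact_imp_bounded bounded_iff by (metis atLeastAtMost_iff imageI real_norm_def)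
  show ?thesis
  proof (rule that[of "max B 1"])
    fix t :: real assume "0 \<le> t"
    then show "\<bar>f t\<bar> \<le> max B 1" using B[of t] T[of t] by (cases "t \<le> T") auto
  qed
qed

text \<open>
  The transform of a bounded signal is holomorphic on the open half-plane, and there it continues the
  rational function \<open>E\<close> from a half-plane further to the right.
\<close>

lemma C0_laplace_no_poles:
  assumes e: "e \<in> C0" and E: "has_laplace e E" and s: "0 \<le> Re s"
  shows "at.ge s 0 E"
proof -
  define f where "f = (\<lambda>t. complex_of_real (e t))"
  have f: "continuous_on {0..} f" "(f \<longlongrightarrow> 0) at_top"
    using e by (auto simp: C0_def f_def intro!: continuous_intros tendsto_eq_intros)
  obtain C where "\<And>t. 0 \<le> t \<Longrightarrow> \<bar>e t\<bar> \<le> C" using C0_bounded[OF e] by blast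
  then have C: "\<And>t. 0 \<le> t \<Longrightarrow> norm (f t) \<le> C" by (simp add: f_def)
  obtain a where a: "\<And>s. Re s > a \<Longrightarrow> laplace f s = rat_eval E s"
    using E unfolding has_laplace_iff f_def by blast
  obtain a' where a': "\<And>s. Re s > a' \<Longrightarrow> at.ge s 0 E"
    using eventually_regular by blast
  let ?A = "poly (cpoly (rnum E))" and ?B = "poly (cpoly (rden E))"
  have eq: "?B z * laplace f z = ?A z" if z: "0 < Re z" for z
  proof (rule analytic_continuation_open[of "{z. max 0 (max a a') < Re z}" "{z. 0 < Re z}"
      "\<lambda>z. ?B z * laplace f z" ?A])
    show "open {z. max 0 (max a a') < Re z}" "open {z. 0 < Re z}"
      by (rule open_halfspace_Re_gt)+
    have "of_real (max 0 (max a a') + 1) \<in> {z. max 0 (max a a') < Re z}"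
      by (simp, linarith)
    then show "{z. max 0 (max a a') < Re z} \<noteq> {}" by blast
    show "connected {z. 0 < Re z}" by (intro convex_connected convex_halfspace_Re_gt)
    show "(\<lambda>z. ?B z * laplace f z) holomorphic_on {z. 0 < Re z}"
      by (intro holomorphic_intros holomorphic_laplace[OF f(1) C])
    show "?A holomorphic_on {z. 0 < Re z}" by (intro holomorphic_intros)
    show "?B x * laplace f x = ?A x" if "x \<in> {z. max 0 (max a a') < Re z}" for x
      using that a[of x] rden_regular[OF a', of x] by (simp add: rat_eval_def)
  qed (use z in auto)
  have "?B s \<noteq> 0"
  proof
    assume B: "?B s = 0"
    have "?A s = 0"
    proof (cases "Re s = 0")
      case False
      then show ?thesis using eq[of s] s B by simp
    next
      case True
      obtain Q where Q: "cpoly (rden E) = [:- s, 1:] * Q"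
        using B by (auto simp: poly_eq_0_iff_dvd dvd_def)
      have "((\<lambda>x. poly Q (s + of_real x) * (of_real x * laplace f (s + of_real x)))
          \<longlongrightarrow> poly Q (s + of_real 0) * 0) (at_right 0)"
        by (intro tendsto_mult laplace_near_imaginary_axis[OF f C True] tendsto_intros)
      moreover have "eventually (\<lambda>x. poly Q (s + of_real x) * (of_real x * laplace f (s + of_real x))
          = ?A (s + of_real x)) (at_right 0)"
        using eventually_at_right_less[of 0]
      proof eventually_elim
        case (elim x)
        have "?B (s + of_real x) = of_real x * poly Q (s + of_real x)"
          by (simp add: Q algebra_simps)
        then show ?case using elim eq[of "s + of_real x"] True by (simp add: mult_ac)
      qed
      ultimately have 1: "((\<lambda>x. ?A (s + of_real x)) \<longlongrightarrow> 0) (at_right 0)"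
        using Lim_transform_eventually by fastforce
      have 2: "((\<lambda>x. ?A (s + of_real x)) \<longlongrightarrow> ?A (s + of_real 0)) (at_right 0)"
        by (intro tendsto_intros)
      show ?thesis using tendsto_unique[OF _ 1 2] by simp
    qed
    then show False using no_common_zero[of E s] B by blast
  qed
  then show ?thesis by (simp add: not_pole_iff[symmetric] is_pole_of_def)
qed

lemma has_laplace_add:
  assumes "has_laplace f F" "has_laplace g G"
  shows "has_laplace (\<lambda>t. f t + g t) (F + G)"
proof -
  obtain a where a: "\<And>s. Re s > a \<Longrightarrow>
      integrable half_line (\<lambda>t. exp (- s * of_real t) * complex_of_real (f t)) \<and>
      laplace (\<lambda>t. of_real (f t)) s = rat_eval F s"
    using assms(1) unfolding has_laplace_iff by blast
  obtain b where b: "\<And>s. Re s > b \<Longrightarrow>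
      integrable half_line (\<lambda>t. exp (- s * of_real t) * complex_of_real (g t)) \<and>
      laplace (\<lambda>t. of_real (g t)) s = rat_eval G s"
    using assms(2) unfolding has_laplace_iff by blast
  obtain c where c: "\<And>s. Re s > c \<Longrightarrow> at.ge s 0 F" using eventually_regular by blast
  obtain d where d: "\<And>s. Re s > d \<Longrightarrow> at.ge s 0 G" using eventually_regular by blast
  show ?thesis unfolding has_laplace_iff
    by (rule exI[of _ "max (max a b) (max c d)"])
      (use a b c d in \<open>auto simp: laplace_def ring_distribs rat_eval_add\<close>)
qed

lemma has_laplace_uminus:
  assumes "has_laplace f F"
  shows "has_laplace (\<lambda>t. - f t) (- F)"
proof -
  obtain a where a: "\<And>s. Re s > a \<Longrightarrow>
      integrable half_line (\<lambda>t. exp (- s * of_real t) * complex_of_real (f t)) \<and>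
      laplace (\<lambda>t. of_real (f t)) s = rat_eval F s"
    using assms(1) unfolding has_laplace_iff by blast
  obtain c where c: "\<And>s. Re s > c \<Longrightarrow> at.ge s 0 F" using eventually_regular by blast
  show ?thesis unfolding has_laplace_iff
    by (rule exI[of _ "max a c"]) (use a c in \<open>auto simp: laplace_def rat_eval_uminus\<close>)
qed

lemma has_laplace_diff:
  assumes "has_laplace f F" "has_laplace g G"
  shows "has_laplace (\<lambda>t. f t - g t) (F - G)"
  using has_laplace_add[OF assms(1) has_laplace_uminus[OF assms(2)]] by simp

section \<open>Initial values\<close>

lemma rat_eval_decay:
  assumes "inf.ge 2 F"
  shows "((\<lambda>x. of_real x * rat_eval F (of_real x)) \<longlongrightarrow> 0) at_top"
proof (cases "F = 0")
  case True
  then show ?thesis by (simp add: rat_eval_def)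
next
  case False
  then have "degree (rnum F) + 2 \<le> degree (rden F)"
    using assms by (simp add: inf.ge_def inf.val_def)
  then have "degree (pCons 0 (cpoly (rnum F))) < degree (cpoly (rden F))"
    using False by (simp add: degree_map_poly)
  then have "((\<lambda>z. poly (pCons 0 (cpoly (rnum F))) z / poly (cpoly (rden F)) z) \<longlongrightarrow> 0) at_infinity"
    by (rule poly_divide_tendsto_0_at_infinity)
  then have "((\<lambda>x. poly (pCons 0 (cpoly (rnum F))) (of_real x) / poly (cpoly (rden F)) (of_real x))
      \<longlongrightarrow> 0) at_top"
    by (rule filterlim_compose) (rule filterlim_of_real_at_infinity)
  then show ?thesis by (simp add: rat_eval_def)
qed

text \<open>
  The initial value theorem \<open>f 0 = lim s F(s)\<close>: for large real \<open>s\<close> the kernel \<open>s exp (- s t)\<close>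
  concentrates at time zero. Decay like \<open>1 / s\<^sup>2\<close> makes the limit zero. The signal may grow
  exponentially, as reference inputs do.
\<close>

lemma initial_value_zero:
  assumes f: "continuous_on {0..} f" and F: "has_laplace f F" and dec: "inf.ge 2 F"
  shows "f 0 = 0"
proof -
  obtain a0 where a0: "\<And>s. Re s > a0 \<Longrightarrow>
      integrable half_line (\<lambda>t. exp (- s * of_real t) * complex_of_real (f t)) \<and>
      laplace (\<lambda>t. of_real (f t)) s = rat_eval F s"
    using F unfolding has_laplace_iff by blast
  define a where "a = max a0 0 + 1"
  have a: "0 < a" "a0 < a" by (auto simp: a_def)
  have K_int: "integrable half_line (\<lambda>t. exp (- (a * t)) * \<bar>f t\<bar>)"
  proof -
    have "integrable half_line (\<lambda>t. norm (exp (- of_real a * of_real t) * complex_of_real (f t)))"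
      using a0[of "of_real a"] a by (intro Bochner_Integration.integrable_norm) auto
    then show ?thesis by (simp add: norm_mult)
  qed
  define K where "K = (\<integral>t. exp (- (a * t)) * \<bar>f t\<bar> \<partial>half_line) + \<bar>f 0\<bar> / a"
  \<comment> \<open>Before the time \<open>d\<close> the signal is close to \<open>f 0\<close>; after it, the excess \<open>x - a\<close> of the rate
    suppresses even an exponentially growing signal.\<close>
  have main: "\<bar>f 0\<bar> \<le> e" if e: "0 < e" for e
  proof -
    have "continuous (at 0 within {0..}) f" using f by (simp add: continuous_on_eq_continuous_within)
    then obtain d where d: "0 < d" "\<And>t. 0 \<le> t \<Longrightarrow> t < d \<Longrightarrow> \<bar>f t - f 0\<bar> < e"
      unfolding continuous_within_eps_delta using e by (auto simp: dist_real_def)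
    have bound: "\<bar>f 0\<bar> \<le> norm (of_real x * rat_eval F (of_real x)) + (e + x * (exp (- ((x - a) * d)) * K))"
      if x: "a < x" for x
    proof -
      have x0: "0 < x" using x a by simp
      let ?E = "\<lambda>t. exp (- complex_of_real x * of_real t)"
      have I1: "integrable half_line (\<lambda>t. ?E t * of_real (f t))"
        "laplace (\<lambda>t. of_real (f t)) (of_real x) = rat_eval F (of_real x)"
        using a0[of "of_real x"] x a by auto
      have I2: "integrable half_line (\<lambda>t. ?E t * of_real (f 0))"
        "(\<integral>t. ?E t * of_real (f 0) \<partial>half_line) = of_real (f 0) / of_real x"
        using laplace_exp[of "of_real x"] x0 by simp_all
      let ?r = "\<lambda>t. e * exp (- (x * t)) + exp (- ((x - a) * d)) *
          (exp (- (a * t)) * \<bar>f t\<bar> + \<bar>f 0\<bar> * exp (- (a * t)))"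
      have J: "integrable half_line ?r"
        using K_int x0 a by (intro Bochner_Integration.integrable_add integrable_mult_right integrable_half_line_exp) auto
      have "norm (\<integral>t. ?E t * of_real (f t) - ?E t * of_real (f 0) \<partial>half_line) \<le> (\<integral>t. ?r t \<partial>half_line)"
      proof (rule Bochner_Integration.integral_norm_bound_integral[OF Bochner_Integration.integrable_diff[OF I1(1) I2(1)] J])
        fix t :: real assume "t \<in> space half_line"
        then have t: "0 \<le> t" by (simp add: space_restrict_space)
        have E: "norm (?E t) = exp (- (x * t))" by (simp add: norm_exp_eq_Re)
        have "norm (?E t * of_real (f t) - ?E t * of_real (f 0)) = exp (- (x * t)) * \<bar>f t - f 0\<bar>"
          unfolding E[symmetric] by (simp add: norm_mult flip: of_real_diff right_diff_distrib)
        also have "\<dots> \<le> ?r t"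
        proof (cases "t < d")
          case True
          then have "exp (- (x * t)) * \<bar>f t - f 0\<bar> \<le> exp (- (x * t)) * e"
            using d(2)[OF t True] by (intro mult_left_mono) auto
          then show ?thesis by (simp add: mult_ac add_increasing2)
        next
          case False
          have "(x - a) * d \<le> (x - a) * t" using x False by (intro mult_left_mono) auto
          then have "exp (- (x * t)) \<le> exp (- ((x - a) * d)) * exp (- (a * t))"
            by (simp add: algebra_simps flip: exp_add)
          then have "exp (- (x * t)) * \<bar>f t - f 0\<bar> \<le>
              (exp (- ((x - a) * d)) * exp (- (a * t))) * (\<bar>f t\<bar> + \<bar>f 0\<bar>)"
            by (intro mult_mono) auto
          also have "\<dots> \<le> ?r t" using e by (simp add: algebra_simps)
          finally show ?thesis .
        qed
        finally show "norm (?E t * of_real (f t) - ?E t * of_real (f 0)) \<le> ?r t" .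
      qed
      also have "(\<integral>t. ?r t \<partial>half_line) = e / x + exp (- ((x - a) * d)) * K"
        unfolding K_def using K_int x0 a integrable_half_line_exp[of x] integrable_half_line_exp[of a]
        by simp
      finally have "norm (rat_eval F (of_real x) - of_real (f 0) / of_real x) \<le> e / x + exp (- ((x - a) * d)) * K"
        using I1 I2 by (simp add: laplace_def)
      then have "x * norm (rat_eval F (of_real x) - of_real (f 0) / of_real x)
          \<le> x * (e / x + exp (- ((x - a) * d)) * K)"
        using x0 by (intro mult_left_mono) auto
      moreover have "x * norm (rat_eval F (of_real x) - of_real (f 0) / of_real x)
          = norm (of_real x * rat_eval F (of_real x) - of_real (f 0))"
      proof -
        have "of_real x * rat_eval F (of_real x) - of_real (f 0)
            = of_real x * (rat_eval F (of_real x) - of_real (f 0) / of_real x)"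
          using x0 by (simp add: right_diff_distrib)
        then show ?thesis using x0 by (simp add: norm_mult)
      qed
      moreover have "\<bar>f 0\<bar> \<le> norm (of_real x * rat_eval F (of_real x))
          + norm (of_real x * rat_eval F (of_real x) - of_real (f 0))"
        using norm_triangle_sub[of "complex_of_real (f 0)" "of_real x * rat_eval F (of_real x)"]
        by (simp add: norm_minus_commute)
      ultimately show ?thesis using x0 by (simp add: distrib_left)
    qed
    have "((\<lambda>x. x * (exp (- ((x - a) * d)) * K)) \<longlongrightarrow> 0) at_top"
      using d(1) by real_asymp
    then have "((\<lambda>x. norm (of_real x * rat_eval F (of_real x)) + (e + x * (exp (- ((x - a) * d)) * K)))
        \<longlongrightarrow> norm (0::complex) + (e + 0)) at_top"
      by (intro tendsto_intros rat_eval_decay[OF dec])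
    then have lim: "((\<lambda>x. norm (of_real x * rat_eval F (of_real x)) + (e + x * (exp (- ((x - a) * d)) * K)))
        \<longlongrightarrow> e) at_top" by simp
    show "\<bar>f 0\<bar> \<le> e"
    proof (rule tendsto_le[OF _ lim tendsto_const])
      show "\<forall>\<^sub>F x in at_top. \<bar>f 0\<bar> \<le> norm (of_real x * rat_eval F (of_real x)) + (e + x * (exp (- ((x - a) * d)) * K))"
        using eventually_gt_at_top[of a] by eventually_elim (rule bound)
    qed simp
  qed
  then show ?thesis using field_le_epsilon[of "\<bar>f 0\<bar>" 0] by simp
qed

section \<open>Exponential sums of constant sign\<close>

text \<open>
  Landau's argument: the transform \<open>\<Phi>\<close> of a signal of constant sign satisfies
  \<open>\<bar>\<Phi> (x + i y)\<bar> \<le> \<bar>\<Phi> x\<bar>\<close>. If the slowest decaying modes were all oscillating, \<open>\<Phi>\<close> would have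
  poles on the line \<open>Re z = - Re s0\<close> but none at its real point. Near that line, the left-hand side
  would be unbounded for a suitable \<open>y\<close> and the right-hand side bounded.
\<close>

lemma slowest_mode_real:
  fixes b :: "complex \<Rightarrow> complex" and A :: "complex set"
  defines "\<phi> \<equiv> \<lambda>t. \<Sum>s\<in>A. b s * exp (- s * of_real t)"
  assumes A: "finite A" 
    and nz: "\<And>s. s \<in> A \<Longrightarrow> b s \<noteq> 0"
    and sign: "\<And>t. 0 \<le> t \<Longrightarrow> \<exists>r\<le>0. \<phi> t = of_real r"
    and s0: "s0 \<in> A" "\<And>s. s \<in> A \<Longrightarrow> Re s0 \<le> Re s"
  shows "\<exists>s\<in>A. Re s = Re s0 \<and> Im s = 0"
proof (rule ccontr)
  assume nonreal: "\<not> ?thesis"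
  have modes: "exp (- z * of_real t) * \<phi> t = (\<Sum>s\<in>A. b s * exp (- (s + z) * of_real t))" for z t
    unfolding \<phi>_def sum_distrib_left
    by (intro sum.cong refl) (simp add: ring_distribs exp_add exp_diff exp_minus field_simps)
  have int: "integrable half_line (\<lambda>t. exp (- z * of_real t) * \<phi> t)"
      "(\<integral>t. exp (- z * of_real t) * \<phi> t \<partial>half_line) = (\<Sum>s\<in>A. b s / (s + z))"
    if z: "- Re s0 < Re z" for z
  proof -
    have p: "0 < Re (s + z)" if "s \<in> A" for s using s0(2)[OF that] z by simp
    show "integrable half_line (\<lambda>t. exp (- z * of_real t) * \<phi> t)"
      unfolding modes using p by (intro Bochner_Integration.integrable_sum integrable_mult_right laplace_exp(1)) auto
    have "(\<integral>t. exp (- z * of_real t) * \<phi> t \<partial>half_line) = (\<Sum>s\<in>A. \<integral>t. b s * exp (- (s + z) * of_real t) \<partial>half_line)"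
      unfolding modes using p by (intro Bochner_Integration.integral_sum integrable_mult_right laplace_exp(1)) auto
    also have "\<dots> = (\<Sum>s\<in>A. b s / (s + z))"
    proof (rule sum.cong[OF refl])
      fix s assume "s \<in> A"
      show "(\<integral>t. b s * exp (- (s + z) * of_real t) \<partial>half_line) = b s / (s + z)"
        unfolding integral_mult_right_zero laplace_exp(2)[OF p[OF \<open>s \<in> A\<close>]] by simp
    qed
    finally show "(\<integral>t. exp (- z * of_real t) * \<phi> t \<partial>half_line) = (\<Sum>s\<in>A. b s / (s + z))" .
  qed
  have le: "norm (\<Sum>s\<in>A. b s / (s + (of_real x + \<i> * of_real y))) \<le> norm (\<Sum>s\<in>A. b s / (s + of_real x))"
    if x: "- Re s0 < x" for x y :: real
  proof -
    define \<psi> where "\<psi> t = - Re (\<phi> t)" for t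
    have \<psi>: "\<phi> t = - of_real (\<psi> t)" "0 \<le> \<psi> t" if "0 \<le> t" for t
      using sign[OF that] by (auto simp: \<psi>_def)
    let ?z = "of_real x + \<i> * of_real y"
    have n: "norm (exp (- ?z * of_real t) * \<phi> t) = exp (- (x * t)) * \<psi> t"
      and m: "exp (- of_real x * of_real t) * \<phi> t = - of_real (exp (- (x * t)) * \<psi> t)" if "0 \<le> t" for t
      using \<psi>[OF that] by (simp_all add: norm_mult norm_exp_eq_Re flip: exp_of_real)
    have "norm (\<Sum>s\<in>A. b s / (s + ?z)) \<le> (\<integral>t. norm (exp (- ?z * of_real t) * \<phi> t) \<partial>half_line)"
      using int(2)[of ?z] x integral_norm_bound[of half_line "\<lambda>t. exp (- ?z * of_real t) * \<phi> t"] by simp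
    also have "\<dots> = (\<integral>t. exp (- (x * t)) * \<psi> t \<partial>half_line)"
      by (intro Bochner_Integration.integral_cong refl n) (simp add: space_restrict_space)
    also have "\<dots> \<le> norm (\<integral>t. complex_of_real (exp (- (x * t)) * \<psi> t) \<partial>half_line)"
      unfolding integral_complex_of_real by simp
    also have "\<dots> = norm (\<integral>t. - complex_of_real (exp (- (x * t)) * \<psi> t) \<partial>half_line)"
      by simp
    also have "(\<integral>t. - complex_of_real (exp (- (x * t)) * \<psi> t) \<partial>half_line)
        = (\<integral>t. exp (- of_real x * of_real t) * \<phi> t \<partial>half_line)"
      by (intro Bochner_Integration.integral_cong refl m[symmetric]) (simp add: space_restrict_space)
    also have "\<dots> = (\<Sum>s\<in>A. b s / (s + of_real x))" using int(2)[of "of_real x"] x by simp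
    finally show ?thesis .
  qed
  \<comment> \<open>Approach the abscissa of convergence, once towards the pole at \<open>- s0\<close> and once along the
    real axis.\<close>
  have pole: "((\<lambda>x. of_real x * (\<Sum>s\<in>A. b s / (s - s0 + of_real x))) \<longlongrightarrow> b s0) (at_right 0)"
  proof -
    have "((\<lambda>x. \<Sum>s\<in>A. of_real x * (b s / (s - s0 + of_real x)))
        \<longlongrightarrow> (\<Sum>s\<in>A. if s = s0 then b s0 else 0)) (at_right 0)"
    proof (intro tendsto_sum)
      fix s assume "s \<in> A"
      show "((\<lambda>x. of_real x * (b s / (s - s0 + of_real x))) \<longlongrightarrow> (if s = s0 then b s0 else 0)) (at_right 0)"
      proof (cases "s = s0")
        case True
        have "eventually (\<lambda>x. of_real x * (b s / (s - s0 + of_real x)) = b s0) (at_right 0)"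
          using eventually_at_right_less[of 0] by eventually_elim (simp add: True)
        then show ?thesis using True by (simp add: tendsto_eventually)
      next
        case False
        have "((\<lambda>x. of_real x * (b s / (s - s0 + of_real x))) \<longlongrightarrow> of_real 0 * (b s / (s - s0 + of_real 0))) (at_right 0)"
          using False by (intro tendsto_intros) auto
        then show ?thesis using False by simp
      qed
    qed
    then show ?thesis using A s0(1) by (simp add: sum_distrib_left)
  qed
  have reg: "((\<lambda>x. of_real x * (\<Sum>s\<in>A. b s / (s - of_real (Re s0) + of_real x))) \<longlongrightarrow> 0) (at_right 0)"
  proof -
    have "((\<lambda>x. of_real x * (\<Sum>s\<in>A. b s / (s - of_real (Re s0) + of_real x)))
        \<longlongrightarrow> of_real 0 * (\<Sum>s\<in>A. b s / (s - of_real (Re s0) + of_real 0))) (at_right 0)"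
      using nonreal by (intro tendsto_intros) (auto simp: complex_eq_iff)
    then show ?thesis by simp
  qed
  have "norm (b s0) \<le> norm (0::complex)"
  proof (rule tendsto_le[OF _ tendsto_norm[OF reg] tendsto_norm[OF pole]])
    show "\<forall>\<^sub>F x in at_right 0. norm (of_real x * (\<Sum>s\<in>A. b s / (s - s0 + of_real x)))
        \<le> norm (of_real x * (\<Sum>s\<in>A. b s / (s - of_real (Re s0) + of_real x)))"
      using eventually_at_right_less[of 0]
    proof eventually_elim
      case (elim x)
      have "of_real (x - Re s0) + \<i> * of_real (- Im s0) = of_real x - s0"
        by (simp add: complex_eq_iff)
      then have "norm (\<Sum>s\<in>A. b s / (s - s0 + of_real x)) \<le> norm (\<Sum>s\<in>A. b s / (s - of_real (Re s0) + of_real x))"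
        using le[of "x - Re s0" "- Im s0"] elim by (simp add: algebra_simps)
      then show ?case using elim by (simp add: norm_mult mult_left_mono)
    qed
  qed simp
  then show False using nz[OF s0(1)] by simp
qed

section \<open>Polynomials in a decaying exponential\<close>

abbreviation const_rat :: "real \<Rightarrow> ratfun" where
  "const_rat c \<equiv> Fract [:c:] 1"

text \<open>The Laplace transform of the signal \<open>\<lambda>t. poly p (exp (- t))\<close>.\<close>

definition exp_transform :: "real poly \<Rightarrow> ratfun" where
  "exp_transform p = (\<Sum>k\<le>degree p. const_rat (coeff p k) * Fract 1 [:real k, 1:])"

lemma exp_transform_alt:
  "degree p \<le> n \<Longrightarrow> exp_transform p = (\<Sum>k\<le>n. const_rat (coeff p k) * Fract 1 [:real k, 1:])"
  unfolding exp_transform_def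
  by (rule sum.mono_neutral_left) (auto simp: coeff_eq_0 fract_collapse)

lemma const_rat_add: "const_rat (a + b) = const_rat a + const_rat b"
  by simp

lemma const_rat_mult: "const_rat (a * b) = const_rat a * const_rat b"
  by (simp add: mult.commute)

lemma exp_transform_add: "exp_transform (p + q) = exp_transform p + exp_transform q"
proof -
  let ?n = "max (degree p) (degree q)"
  have "degree (p + q) \<le> ?n" by (rule degree_add_le_max)
  then show ?thesis
    by (simp only: exp_transform_alt[of _ ?n] max.cobounded1 max.cobounded2 coeff_add
        const_rat_add distrib_right sum.distrib)
qed

lemma exp_transform_smult: "exp_transform (smult c p) = const_rat c * exp_transform p"
proof -
  have "degree (smult c p) \<le> degree p" by simp
  then show ?thesis
    by (simp only: exp_transform_alt[of _ "degree p"] order_refl coeff_smult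
        const_rat_mult mult.assoc sum_distrib_left)
qed

lemma exp_transform_diff: "exp_transform (p - q) = exp_transform p - exp_transform q"
  using exp_transform_add[of "p - q" q] by simp

lemma exp_transform_sum: "exp_transform (\<Sum>i\<in>I. p i) = (\<Sum>i\<in>I. exp_transform (p i))"
proof (induction I rule: infinite_finite_induct)
  case (insert i I)
  then show ?case by (simp add: exp_transform_add)
qed (simp_all add: exp_transform_def fract_collapse)

lemma exp_transform_regular:
  assumes "poly p 0 = 0" "0 \<le> Re s"
  shows "at.ge s 0 (exp_transform p)"
    and "rat_eval (exp_transform p) s = (\<Sum>k\<le>degree p. of_real (coeff p k) / (s + of_nat k))"
proof -
  have r: "at.ge s 0 (const_rat (coeff p k) * Fract 1 [:real k, 1:]) \<and>
      rat_eval (const_rat (coeff p k) * Fract 1 [:real k, 1:]) s = of_real (coeff p k) / (s + of_nat k)" for k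
  proof (cases "k = 0")
    case True
    then show ?thesis using assms(1) by (simp add: poly_0_coeff_0 fract_collapse rat_eval_def)
  next
    case False
    then have "Re s + real k \<noteq> 0" using assms(2) by linarith
    then have "s + of_nat k \<noteq> 0" by (auto simp: complex_eq_iff)
    then have "poly (cpoly [:real k, 1:]) s \<noteq> 0" by (simp add: map_poly_pCons add.commute)
    then show ?thesis
      using rat_eval_Fract[of "[:real k, 1:]" s "[:coeff p k:]"] by (simp add: map_poly_pCons add.commute)
  qed
  have "at.ge s 0 (\<Sum>k\<in>K. const_rat (coeff p k) * Fract 1 [:real k, 1:]) \<and>
    rat_eval (\<Sum>k\<in>K. const_rat (coeff p k) * Fract 1 [:real k, 1:]) s
      = (\<Sum>k\<in>K. of_real (coeff p k) / (s + of_nat k))" if "finite K" for K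
    using that
  proof induction
    case empty
    then show ?case by (simp add: rat_eval_def)
  next
    case (insert k K)
    then show ?case using r[of k] by (auto intro: at.ge_add simp: rat_eval_add)
  qed
  then show "at.ge s 0 (exp_transform p)"
    and "rat_eval (exp_transform p) s = (\<Sum>k\<le>degree p. of_real (coeff p k) / (s + of_nat k))"
    unfolding exp_transform_def by blast+
qed

lemma laplace_poly_exp:
  assumes p: "poly p 0 = 0" and z: "0 < Re z"
  shows "integrable half_line (\<lambda>t. exp (- z * of_real t) * complex_of_real (poly p (exp (- t))))"
    and "laplace (\<lambda>t. of_real (poly p (exp (- t)))) z = rat_eval (exp_transform p) z"
proof -
  have modes: "exp (- z * of_real t) * complex_of_real (poly p (exp (- t)))
      = (\<Sum>k\<le>degree p. of_real (coeff p k) * exp (- (z + of_nat k) * of_real t))" for t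
  proof -
    have "complex_of_real (exp (- t) ^ k) = exp (- (of_nat k * of_real t))" for k
      by (simp add: exp_of_nat_mult[symmetric] flip: exp_of_real)
    then show ?thesis
      by (simp add: poly_altdef sum_distrib_left mult_ac ring_distribs exp_diff exp_minus field_simps exp_add)
  qed
  have pos: "0 < Re (z + of_nat k)" for k using z by simp
  show "integrable half_line (\<lambda>t. exp (- z * of_real t) * complex_of_real (poly p (exp (- t))))"
    unfolding modes using pos by (intro Bochner_Integration.integrable_sum integrable_mult_right laplace_exp(1))
  have "laplace (\<lambda>t. of_real (poly p (exp (- t)))) z
      = (\<Sum>k\<le>degree p. \<integral>t. of_real (coeff p k) * exp (- (z + of_nat k) * of_real t) \<partial>half_line)"
    unfolding laplace_def modes using pos
    by (intro Bochner_Integration.integral_sum integrable_mult_right laplace_exp(1))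
  also have "\<dots> = (\<Sum>k\<le>degree p. of_real (coeff p k) / (z + of_nat k))"
    unfolding integral_mult_right_zero laplace_exp(2)[OF pos] by simp
  finally show "laplace (\<lambda>t. of_real (poly p (exp (- t)))) z = rat_eval (exp_transform p) z"
    using exp_transform_regular(2)[OF p, of z] z by simp
qed

lemma has_laplace_poly_exp:
  "poly p 0 = 0 \<Longrightarrow> has_laplace (\<lambda>t. poly p (exp (- t))) (exp_transform p)"
  unfolding has_laplace_iff using laplace_poly_exp[of p] by (intro exI[of _ 0]) blast

text \<open>
  The Beta integral: \<open>\<integral> e\<^bsup>-st\<^esup> e\<^bsup>-kt\<^esup> (e\<^bsup>-t\<^esup> - 1)\<^sup>N dt = (-1)\<^sup>N N! / ((s + k) \<dots> (s + k + N))\<close>.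
\<close>

lemma exp_transform_beta:
  "exp_transform (monom 1 k * [:-1, 1:] ^ N)
    = const_rat ((-1) ^ N * fact N) * Fract 1 (\<Prod>j\<le>N. [:real (k + j), 1:])"
proof (induction N arbitrary: k)
  case 0
  have "degree (monom (1::real) k) \<le> k" by (rule degree_monom_le)
  then have "exp_transform (monom 1 k) = (\<Sum>i\<le>k. const_rat (coeff (monom 1 k) i) * Fract 1 [:real i, 1:])"
    by (rule exp_transform_alt)
  also have "\<dots> = (\<Sum>i\<le>k. if i = k then Fract 1 [:real k, 1:] else 0)"
    by (intro sum.cong refl) (auto simp: fract_collapse one_pCons[symmetric])
  finally show ?case by (simp add: one_pCons[symmetric] fract_collapse)
next
  case (Suc N)
  let ?Q = "\<lambda>k N. \<Prod>j\<le>N. [:real (k + j), 1:]"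
  let ?c = "const_rat ((-1) ^ N * fact N)"
  have nz: "?Q k n \<noteq> 0" for k n by simp
  have split: "?Q k (Suc N) = ?Q k N * [:real (k + Suc N), 1:]"
    "?Q k (Suc N) = [:real k, 1:] * ?Q (Suc k) N"
    by (rule prod.atMost_Suc) (simp only: prod.atMost_Suc_shift add_0_right add_Suc_right add_Suc)
  have "monom 1 k * [:-1, 1:] ^ Suc N
      = monom 1 (Suc k) * [:-1, 1:] ^ N - (monom 1 k * [:-1, 1:] ^ N :: real poly)"
  proof -
    have X: "q * [:-1, 1:] = pCons 0 q - q" for q :: "real poly"
    proof -
      have "smult (-1) q = - q" by (metis smult_minus_left smult_1_left)
      then show ?thesis by simp
    qed
    have "monom 1 k * [:-1, 1:] ^ Suc N = (monom 1 k * [:-1, 1:] ^ N) * [:-1, 1 :: real:]"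
      by (simp only: power_Suc2 mult.assoc)
    then show ?thesis
      by (simp only: X monom_Suc mult_pCons_left smult_0_left add_0_left)
  qed
  then have "exp_transform (monom 1 k * [:-1, 1:] ^ Suc N)
      = ?c * (Fract 1 (?Q (Suc k) N) - Fract 1 (?Q k N))"
    by (simp only: exp_transform_diff Suc.IH right_diff_distrib)
  also have "Fract 1 (?Q (Suc k) N) = Fract [:real k, 1:] (?Q k (Suc N))"
    using mult_fract_cancel[of "[:real k, 1:]" 1 "?Q (Suc k) N"] by (simp only: split(2) mult_1_right) simp
  also have "Fract 1 (?Q k N) = Fract [:real (k + Suc N), 1:] (?Q k (Suc N))"
    using mult_fract_cancel[of "[:real (k + Suc N), 1:]" 1 "?Q k N"]
    by (simp only: split(1) mult_1_right mult.commute[of "?Q k N"]) simp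
  also have "Fract [:real k, 1:] (?Q k (Suc N)) - Fract [:real (k + Suc N), 1:] (?Q k (Suc N))
      = const_rat (- real (Suc N)) * Fract 1 (?Q k (Suc N))"
  proof -
    have "Fract a F - Fract b F = Fract (a - b) 1 * Fract 1 F" for a b F :: "real poly"
    proof -
      have "Fract a F - Fract b F = Fract a 1 * Fract 1 F - Fract b 1 * Fract 1 F"
        by simp
      also have "\<dots> = (Fract a 1 - Fract b 1) * Fract 1 F" by (simp only: left_diff_distrib)
      finally show ?thesis by simp
    qed
    moreover have "[:real k, 1:] - [:real (k + Suc N), 1:] = [:- real (Suc N):]" by simp
    ultimately show ?thesis by presburger
  qed
  finally have "exp_transform (monom 1 k * [:-1, 1:] ^ Suc N)
      = (?c * const_rat (- real (Suc N))) * Fract 1 (?Q k (Suc N))"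
    by (simp only: mult.assoc)
  also have "?c * const_rat (- real (Suc N)) = const_rat (((-1) ^ N * fact N) * - real (Suc N))"
    by (rule const_rat_mult[symmetric])
  also have "((-1) ^ N * fact N) * - real (Suc N) = (-1) ^ Suc N * fact (Suc N)"
    by (simp add: algebra_simps)
  finally show ?case .
qed

lemma const_rat_ge: "inf.ge 0 (const_rat c)"
  by (cases "c = 0") (auto simp: fract_collapse inf.ge_def inf.val_Fract)

lemma exp_transform_beta_val:
  "exp_transform (monom 1 k * [:-1, 1:] ^ N) \<noteq> 0"
  "inf.val (exp_transform (monom 1 k * [:-1, 1:] ^ N)) = int N + 1"
proof -
  let ?Q = "\<Prod>j\<le>N. [:real (k + j), 1:]" and ?c = "(-1) ^ N * fact N :: real"
  have nz: "?Q \<noteq> 0" "[:?c:] \<noteq> 0" by simp_all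
  have F: "exp_transform (monom 1 k * [:-1, 1:] ^ N) = Fract [:?c:] ?Q"
    unfolding exp_transform_beta by simp
  have "degree ?Q = N + 1" by (subst degree_prod_sum_eq) simp_all
  then show "inf.val (exp_transform (monom 1 k * [:-1, 1:] ^ N)) = int N + 1"
    unfolding F inf.val_Fract[OF nz(2,1)] by simp
  show "exp_transform (monom 1 k * [:-1, 1:] ^ N) \<noteq> 0"
    unfolding F using nz by (simp add: Zero_fract_def eq_fract)
qed

text \<open>
  Contact of order \<open>N\<close> with zero at time zero, that is at \<open>exp (- t) = 1\<close>, means a transform that
  decays like \<open>s\<close> to the power \<open>- N - 1\<close>.
\<close>

lemma exp_transform_flat:
  assumes "poly p 0 = 0" "[:-1, 1:] ^ N dvd p"
  shows "inf.ge (int N + 1) (exp_transform p)"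
proof -
  obtain v where v: "p = [:-1, 1:] ^ N * v" using assms(2) by (rule dvdE)
  then have "poly v 0 = 0" using assms(1) by simp
  then obtain u where u: "v = pCons 0 u" by (cases v) auto
  have "v = monom 1 1 * (\<Sum>i\<le>degree u. monom (coeff u i) i)"
    by (simp add: u monom_Suc poly_as_sum_of_monoms)
  also have "\<dots> = (\<Sum>i\<le>degree u. smult (coeff u i) (monom 1 (Suc i)))"
    by (simp add: sum_distrib_left mult_monom smult_monom)
  finally have "p = (\<Sum>i\<le>degree u. smult (coeff u i) (monom 1 (Suc i) * [:-1, 1:] ^ N))"
    by (simp only: v sum_distrib_left mult_smult_left mult.commute)
  then have "exp_transform p = (\<Sum>i\<le>degree u. const_rat (coeff u i) * exp_transform (monom 1 (Suc i) * [:-1, 1:] ^ N))"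
    by (simp add: exp_transform_sum exp_transform_smult)
  moreover have "inf.ge (0 + (int N + 1)) (const_rat (coeff u i) * exp_transform (monom 1 (Suc i) * [:-1, 1:] ^ N))" for i
    using exp_transform_beta_val[of "Suc i" N]
    by (intro inf.ge_mult const_rat_ge) (simp add: inf.ge_def)
  ultimately show ?thesis by (simp add: inf.ge_sum)
qed

lemma leading_constant:
  assumes "inf.ge k F" "H \<noteq> 0" "inf.val H = k"
  obtains c where "inf.ge (k + 1) (F - const_rat c * H)"
proof (cases "inf.ge (k + 1) F")
  case True
  then show ?thesis using that[of 0] by (simp add: fract_collapse)
next
  case False
  then have F: "F \<noteq> 0" "inf.val F = k" using assms(1) by (auto simp: inf.ge_def)
  define R where "R = F / H"
  have R: "R \<noteq> 0" "inf.val R = 0" using F assms by (auto simp: R_def inf.val_divide)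
  let ?a = "rnum R" and ?b = "rden R"
  have deg: "degree ?a = degree ?b" using R by (simp add: inf.val_def)
  define c where "c = lead_coeff ?a / lead_coeff ?b"
  have "R - const_rat c = Fract ?a ?b - const_rat c" by (simp add: Fract_rnum_rden)
  also have "\<dots> = Fract (?a - smult c ?b) ?b" by simp
  finally have e: "R - const_rat c = Fract (?a - smult c ?b) ?b" .
  have "inf.ge 1 (R - const_rat c)"
  proof (cases "?a - smult c ?b = 0")
    case True
    then show ?thesis unfolding e by (simp add: fract_collapse)
  next
    case False
    have "coeff (?a - smult c ?b) (degree ?b) = 0"
      using deg by (simp add: c_def)
    moreover have "degree (?a - smult c ?b) \<le> degree ?b"
      using deg by (intro degree_diff_le) auto
    ultimately have "degree (?a - smult c ?b) < degree ?b"
      using False by (metis le_neq_implies_less leading_coeff_0_iff)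
    then show ?thesis unfolding e using False by (simp add: inf.ge_def inf.val_Fract)
  qed
  then have "inf.ge (1 + k) ((R - const_rat c) * H)"
    using assms by (intro inf.ge_mult) (simp_all add: inf.ge_def)
  moreover have "(R - const_rat c) * H = F - const_rat c * H"
    using assms(2) by (simp add: R_def left_diff_distrib)
  ultimately show ?thesis using that[of c] by (simp add: add.commute)
qed

text \<open>
  Every strictly proper function has the expansion at infinity, to any given order, of such a
  transform: the transforms of \<open>x (x - 1)\<^sup>n\<close> have exact order \<open>n + 1\<close> at infinity, so the expansion
  can be matched term by term.
\<close>

lemma match_at_infinity:
  assumes "inf.ge 1 G"
  shows "\<exists>r. poly r 0 = 0 \<and> inf.ge (int N) (exp_transform r - G)"
proof (induction N)
  case 0
  show ?case using assms
    by (intro exI[of _ 0]) (auto simp: exp_transform_def fract_collapse intro: inf.ge_mono)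
next
  case (Suc N)
  show ?case
  proof (cases N)
    case 0
    then show ?thesis using assms
      by (intro exI[of _ 0]) (auto simp: exp_transform_def fract_collapse)
  next
    case (Suc n)
    obtain r where r: "poly r 0 = 0" "inf.ge (int N) (exp_transform r - G)" using Suc.IH by blast
    let ?h = "monom 1 1 * [:-1, 1:] ^ n :: real poly"
    obtain c where "inf.ge (int N + 1) (exp_transform r - G - const_rat c * exp_transform ?h)"
      using leading_constant[OF r(2), of "exp_transform ?h"] exp_transform_beta_val[of 1 n] Suc by auto
    then show ?thesis using r(1)
      by (intro exI[of _ "r - smult c ?h"])
        (simp add: exp_transform_diff exp_transform_smult poly_monom algebra_simps)
  qed
qed

section \<open>Uniform approximation with prescribed behaviour at time zero\<close>

lemma bump_bound:
  fixes x :: real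
  assumes "0 \<le> x" "x \<le> 1"
  shows "(1 - x) * x ^ K \<le> 1 / (real K + 1)"
proof -
  have "(real K + 1) * ((1 - x) * x ^ K) = (1 - x) * (\<Sum>j\<le>K. x ^ K)" by simp
  also have "\<dots> \<le> (1 - x) * (\<Sum>j\<le>K. x ^ j)"
    using assms by (intro mult_left_mono sum_mono power_decreasing) auto
  also have "\<dots> = 1 - x ^ Suc K" using one_diff_power_eq'[of x "Suc K"]
    by (simp add: lessThan_Suc_atMost sum_gp_basic)
  also have "\<dots> \<le> 1" using assms by simp
  finally show ?thesis by (simp add: field_simps)
qed

text \<open>
  Derivatives at an end point are unbounded functionals for the uniform norm, so they can be
  prescribed at no cost: the \<open>m\<close>-th one is adjusted by a multiple of \<open>(1 - x)\<^sup>m x\<^sup>K\<close> with \<open>K\<close> large.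
\<close>

lemma small_poly_with_jet:
  fixes q :: "real poly"
  assumes q: "poly q 1 = 0" and e: "0 < e"
  shows "\<exists>p. poly p 0 = 0 \<and> [:-1, 1:] ^ m dvd p - q \<and> (\<forall>x. 0 \<le> x \<and> x \<le> 1 \<longrightarrow> \<bar>poly p x\<bar> \<le> e)"
  using e
proof (induction m arbitrary: e)
  case 0
  then show ?case by (intro exI[of _ 0]) auto
next
  case (Suc m)
  show ?case
  proof (cases m)
    case 0
    have "[:-1, 1:] dvd q" using q by (simp add: poly_eq_0_iff_dvd)
    then show ?thesis using Suc.prems 0 by (intro exI[of _ 0]) auto
  next
    case (Suc m')
    obtain p where p: "poly p 0 = 0" "[:-1, 1:] ^ m dvd p - q"
      "\<And>x. 0 \<le> x \<Longrightarrow> x \<le> 1 \<Longrightarrow> \<bar>poly p x\<bar> \<le> e / 2"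
      using Suc.IH[of "e / 2"] Suc.prems by auto
    obtain u where u: "p - q = [:-1, 1:] ^ m * u" using p(2) by (rule dvdE)
    define c where "c = poly u 1"
    obtain K :: nat where K: "2 * \<bar>c\<bar> / e < real K" using reals_Archimedean2 by blast
    have K0: "0 < K" using K Suc.prems by (metis abs_ge_zero divide_nonneg_pos gr0I leD mult_nonneg_nonneg of_nat_0 zero_le_numeral)
    let ?b = "[:-1, 1:] ^ m * monom 1 K :: real poly"
    have "p - smult c ?b - q = [:-1, 1:] ^ m * (u - smult c (monom 1 K))"
      using u by (simp add: algebra_simps)
    moreover have "[:-1, 1:] dvd u - smult c (monom 1 K)"
    proof -
      have "poly (u - smult c (monom 1 K)) 1 = 0" by (simp add: c_def poly_monom)
      then show ?thesis by (simp only: poly_eq_0_iff_dvd)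
    qed
    ultimately have "[:-1, 1:] ^ Suc m dvd p - smult c ?b - q"
      by (simp only: power_Suc2 mult_dvd_mono dvd_refl)
    moreover have "poly (p - smult c ?b) 0 = 0" using p(1) K0 by (simp add: poly_monom)
    moreover have "\<bar>poly (p - smult c ?b) x\<bar> \<le> e" if x: "0 \<le> x" "x \<le> 1" for x
    proof -
      have "\<bar>poly ?b x\<bar> = (1 - x) ^ m * x ^ K"
        using x by (simp add: poly_monom abs_mult power_abs)
      also have "\<dots> \<le> (1 - x) * x ^ K"
        using x power_decreasing[of 1 m "1 - x"] Suc by (intro mult_right_mono) auto
      also have "\<dots> \<le> 1 / (real K + 1)" using bump_bound[OF x] .
      finally have "\<bar>c\<bar> * \<bar>poly ?b x\<bar> \<le> \<bar>c\<bar> * (1 / (real K + 1))" by (intro mult_left_mono) auto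
      also have "\<dots> \<le> e / 2" using K Suc.prems by (simp add: field_simps)
      finally have "\<bar>poly (smult c ?b) x\<bar> \<le> e / 2" by (simp only: poly_smult abs_mult)
      then show ?thesis using p(3)[OF x] abs_triangle_ineq4[of "poly p x" "poly (smult c ?b) x"]
        unfolding poly_diff by linarith
    qed
    ultimately show ?thesis by blast
  qed
qed

text \<open>
  With \<open>x = exp (- t)\<close> this is uniform approximation on the unit interval, where \<open>x = 0\<close> is the
  infinite future. The affine correction of the Weierstrass polynomial makes both end point values
  exact; only then can the remaining defect at \<open>x = 1\<close> be removed by a small polynomial.
\<close>

lemma poly_exp_dense:
  assumes f: "f \<in> C0" "f 0 = poly r 1" and r: "poly r 0 = 0" and e: "0 < e"
  obtains p where "poly p 0 = 0" "[:-1, 1:] ^ m dvd p - r"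
    "\<And>t. 0 \<le> t \<Longrightarrow> \<bar>poly p (exp (- t)) - f t\<bar> \<le> e"
proof -
  have fc: "continuous_on {0..} f" and fl: "(f \<longlongrightarrow> 0) at_top" using f by (auto simp: C0_def)
  define b where "b x = (if x \<le> 0 then 0 else f (- ln x))" for x
  have "continuous_on {0..1} b"
    unfolding continuous_on_def
  proof
    fix x :: real assume x: "x \<in> {0..1}"
    show "(b \<longlongrightarrow> b x) (at x within {0..1})"
    proof (cases "x = 0")
      case True
      have "((\<lambda>x. f (- ln x)) \<longlongrightarrow> 0) (at_right 0)"
        by (rule filterlim_compose[OF fl]) (subst filterlim_uminus_at_top, simp add: ln_at_0)
      then have "(b \<longlongrightarrow> 0) (at_right 0)"
        by (rule Lim_transform_eventually)
          (auto simp: b_def intro!: eventually_mono[OF eventually_at_right_less[of 0]])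
      then have "(b \<longlongrightarrow> 0) (at 0 within {0..1})"
        by (simp add: at_within_Icc_at_right)
      then show ?thesis using True by (simp add: b_def)
    next
      case False
      have "continuous_on {0<..1} (\<lambda>x. f (- ln x))"
        by (rule continuous_on_compose2[OF fc]) (auto intro!: continuous_intros)
      then have "((\<lambda>x. f (- ln x)) \<longlongrightarrow> f (- ln x)) (at x within {0<..1})"
        using x False by (auto simp: continuous_on_def)
      moreover have "at x within {0<..1} = at x within {0..1}"
        using x False by (intro at_within_nhd[of _ "{0<..}"]) auto
      moreover have "eventually (\<lambda>y. f (- ln y) = b y) (at x within {0..1})"
        using x False eventually_at_in_open'[of "{0<..}" x]
        by (auto simp: b_def eventually_at_filter elim!: eventually_mono
            intro: eventually_mono[OF eventually_nhds_in_open[of "{0<..}" x]])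
      ultimately show ?thesis using x False by (auto simp: b_def intro: Lim_transform_eventually)
    qed
  qed
  then obtain g where g: "real_polynomial_function g" "\<And>x. x \<in> {0..1} \<Longrightarrow> \<bar>b x - g x\<bar> < e / 4"
    using Stone_Weierstrass_real_polynomial_function[of "{0..1::real}" b "e / 4"] e by auto
  obtain a n where "g = (\<lambda>x. \<Sum>i\<le>n. a i * x ^ i)"
    using g(1) real_polynomial_function_iff_sum by blast
  then have gq: "g x = poly (\<Sum>i\<le>n. monom (a i) i) x" for x by (simp add: poly_sum poly_monom)
  define q where "q = (\<Sum>i\<le>n. monom (a i) i)"
  define q1 where "q1 = q - smult (poly q 0) [:1, -1:] - smult (poly q 1 - poly r 1) [:0, 1:]"
  have b0: "b 0 = 0" "b 1 = poly r 1" using f by (simp_all add: b_def)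
  have q0: "\<bar>poly q 0\<bar> \<le> e / 4" "\<bar>poly q 1 - poly r 1\<bar> \<le> e / 4"
    using g(2)[of 0] g(2)[of 1] b0 by (auto simp: gq q_def[symmetric] abs_minus_commute)
  have q1: "poly q1 0 = 0" "poly (r - q1) 1 = 0" by (simp_all add: q1_def)
  have q1b: "\<bar>poly q1 x - b x\<bar> \<le> 3 * e / 4" if x: "0 \<le> x" "x \<le> 1" for x
  proof -
    have "\<bar>poly q 0 * (1 - x)\<bar> \<le> e / 4 * 1"
      unfolding abs_mult using q0(1) x e by (intro mult_mono) auto
    moreover have "\<bar>(poly q 1 - poly r 1) * x\<bar> \<le> e / 4 * 1"
      unfolding abs_mult using q0(2) x e by (intro mult_mono) auto
    moreover have "\<bar>b x - poly q x\<bar> < e / 4" using g(2)[of x] x by (simp add: gq q_def)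
    moreover have "poly q1 x = poly q x - poly q 0 * (1 - x) - (poly q 1 - poly r 1) * x"
      by (simp add: q1_def algebra_simps)
    ultimately show ?thesis by linarith
  qed
  obtain p where p: "poly p 0 = 0" "[:-1, 1:] ^ m dvd p - (r - q1)"
      "\<And>x. 0 \<le> x \<Longrightarrow> x \<le> 1 \<Longrightarrow> \<bar>poly p x\<bar> \<le> e / 4"
    using small_poly_with_jet[OF q1(2), of "e / 4" m] e by auto
  show ?thesis
  proof (rule that[of "q1 + p"])
    show "poly (q1 + p) 0 = 0" using p q1 by simp
    show "[:-1, 1:] ^ m dvd q1 + p - r" using p(2) by (simp add: algebra_simps)
    fix t :: real assume t: "0 \<le> t"
    then have x: "0 \<le> exp (- t)" "exp (- t) \<le> 1" by simp_all
    have "b (exp (- t)) = f t" by (simp add: b_def not_le)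
    then show "\<bar>poly (q1 + p) (exp (- t)) - f t\<bar> \<le> e"
      using q1b[OF x] p(3)[OF x] unfolding poly_add by linarith
  qed
qed

section \<open>A separation criterion\<close>

text \<open>
  If no linear functional is non-positive on the convex set \<open>S\<close> without vanishing on it, the
  origin lies in the relative interior of \<open>S\<close>, hence in \<open>S\<close>. The index set is finite but
  arbitrary, so the proof adds one coordinate at a time, with a separation in the plane at each
  step, instead of separating in a space whose dimension is fixed by a type.
\<close>

lemma convex_contains_zero:
  fixes S :: "('i \<Rightarrow> real) set"
  assumes "finite I" "S \<noteq> {}"
    and "\<And>x y t. x \<in> S \<Longrightarrow> y \<in> S \<Longrightarrow> 0 \<le> t \<Longrightarrow> t \<le> 1 \<Longrightarrow> (\<lambda>i. (1 - t) * x i + t * y i) \<in> S"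
    and "\<And>a. (\<exists>x\<in>S. 0 < (\<Sum>i\<in>I. a i * x i)) \<or> (\<forall>x\<in>S. (\<Sum>i\<in>I. a i * x i) = 0)"
  shows "\<exists>x\<in>S. \<forall>i\<in>I. x i = 0"
  using assms
proof (induction I arbitrary: S rule: finite_induct)
  case empty
  then show ?case by auto
next
  case (insert j I S)
  note conv = insert.prems(2) and alt = insert.prems(3)
  have split: "(\<Sum>i\<in>insert j I. (if i = j then \<beta> else \<alpha> * a i) * x i)
      = \<beta> * x j + \<alpha> * (\<Sum>i\<in>I. a i * x i)" for \<alpha> \<beta> :: real and a x
  proof -
    have "(\<Sum>i\<in>I. (if i = j then \<beta> else \<alpha> * a i) * x i) = (\<Sum>i\<in>I. \<alpha> * a i * x i)"
      using insert.hyps(2) by (intro sum.cong) auto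
    then show ?thesis using insert.hyps by (simp add: sum_distrib_left mult.assoc)
  qed
  define S' where "S' = {x \<in> S. x j = 0}"
  have "\<exists>x\<in>S'. \<forall>i\<in>I. x i = 0"
  proof (rule insert.IH)
    have A: "(\<exists>x\<in>S. 0 < x j) \<or> (\<forall>x\<in>S. x j = 0)" "(\<exists>x\<in>S. x j < 0) \<or> (\<forall>x\<in>S. x j = 0)"
      using alt[of "\<lambda>i. if i = j then 1 else 0 * 0"] alt[of "\<lambda>i. if i = j then -1 else 0 * 0"]
      unfolding split by simp_all
    show "S' \<noteq> {}"
    proof (cases "\<forall>x\<in>S. x j = 0")
      case True
      then show ?thesis using insert.prems(1) by (auto simp: S'_def)
    next
      case False
      then obtain x y where xy: "x \<in> S" "0 < x j" "y \<in> S" "y j < 0" using A by blast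
      define t where "t = x j / (x j - y j)"
      have "0 \<le> t" "t \<le> 1" using xy by (auto simp: t_def field_simps)
      moreover have "(1 - t) * x j + t * y j = 0" using xy by (simp add: t_def field_simps)
      ultimately show ?thesis using conv[OF xy(1,3), of t] by (auto simp: S'_def)
    qed
    show "(\<lambda>i. (1 - t) * x i + t * y i) \<in> S'" if "x \<in> S'" "y \<in> S'" "0 \<le> t" "t \<le> 1" for x y t
      using conv that by (auto simp: S'_def)
    fix a :: "'i \<Rightarrow> real"
    let ?u = "\<lambda>x. \<Sum>i\<in>I. a i * x i"
    show "(\<exists>x\<in>S'. 0 < ?u x) \<or> (\<forall>x\<in>S'. ?u x = 0)"
    proof (rule disjCI)
      assume no: "\<not> (\<forall>x\<in>S'. ?u x = 0)"
      show "\<exists>x\<in>S'. 0 < ?u x"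
      proof (rule ccontr)
        assume neg: "\<not> ?thesis"
        let ?K = "(\<lambda>x. (?u x, x j)) ` S" and ?R = "{0<..} \<times> {0} :: (real \<times> real) set"
        have "convex ?K"
        proof (rule convexI)
          fix v w :: "real \<times> real" and s t :: real
          assume v: "v \<in> ?K" "w \<in> ?K" and st: "0 \<le> s" "0 \<le> t" "s + t = 1"
          from v obtain x y where xy: "x \<in> S" "v = (?u x, x j)" "y \<in> S" "w = (?u y, y j)" by auto
          have s: "s = 1 - t" using st by simp
          let ?z = "\<lambda>i. (1 - t) * x i + t * y i"
          have z: "?z \<in> S" using conv[OF xy(1,3), of t] st by simp
          have "?u ?z = (\<Sum>i\<in>I. (1 - t) * (a i * x i) + t * (a i * y i))"
            by (intro sum.cong refl) (simp add: algebra_simps)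
          also have "\<dots> = (1 - t) * ?u x + t * ?u y"
            by (simp only: sum.distrib sum_distrib_left)
          finally have e: "s *\<^sub>R v + t *\<^sub>R w = (?u ?z, ?z j)"
            by (simp only: xy s scaleR_Pair add_Pair real_scaleR_def)
          show "s *\<^sub>R v + t *\<^sub>R w \<in> ?K" unfolding e by (rule image_eqI[OF _ z], rule refl)
        qed
        moreover have "convex ?R" by (intro convex_Times convex_real_interval convex_singleton)
        moreover have "?K \<noteq> {}" using insert.prems(1) by auto
        moreover have "?R \<noteq> {}" by (auto intro: exI[of _ 1])
        moreover have "?K \<inter> ?R = {}" using neg by (auto simp: S'_def)
        ultimately obtain n b where n: "n \<noteq> 0" "\<forall>v\<in>?K. inner n v \<le> b" "\<forall>v\<in>?R. b \<le> inner n v"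
          using separating_hyperplane_sets[of ?K ?R] by blast
        obtain \<alpha> \<beta> where ab: "n = (\<alpha>, \<beta>)" by (cases n)
        have R: "b \<le> \<alpha> * t" if "0 < t" for t
        proof -
          have "(t, 0) \<in> ?R" using that by simp
          then show ?thesis using n(3) ab by fastforce
        qed
        have b: "b \<le> 0"
        proof (rule tendsto_lowerbound)
          show "((\<lambda>t. \<alpha> * t) \<longlongrightarrow> 0) (at_right 0)" by (auto intro!: tendsto_eq_intros)
          show "\<forall>\<^sub>F t in at_right 0. b \<le> \<alpha> * t"
            using eventually_at_right_less[of 0] by eventually_elim (rule R)
        qed simp
        have \<alpha>: "0 \<le> \<alpha>"
        proof (rule ccontr)
          assume "\<not> 0 \<le> \<alpha>"
          then have "\<alpha> * ((\<bar>b\<bar> + 1) / - \<alpha>) = - (\<bar>b\<bar> + 1)" "0 < (\<bar>b\<bar> + 1) / - \<alpha>"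
            by (simp_all add: field_simps)
          then show False using R[of "(\<bar>b\<bar> + 1) / - \<alpha>"] by linarith
        qed
        have "\<beta> * x j + \<alpha> * ?u x \<le> 0" if "x \<in> S" for x
          using n(2) that b ab by (fastforce simp: add.commute)
        then have eq: "\<beta> * x j + \<alpha> * ?u x = 0" if "x \<in> S" for x
          using alt[of "\<lambda>i. if i = j then \<beta> else \<alpha> * a i"] that unfolding split by force
        show False
        proof (cases "\<alpha> = 0")
          case False
          obtain x where x: "x \<in> S" "x j = 0" "?u x \<noteq> 0" using no by (auto simp: S'_def)
          have "\<alpha> * ?u x = 0" using eq[OF x(1)] x(2) by simp
          then show False using False x(3) by simp
        next
          case True
          then have "\<beta> \<noteq> 0" using n(1) ab by (simp add: zero_prod_def)
          then have "S' = S" using eq True by (auto simp: S'_def)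
          then show False
            using alt[of "\<lambda>i. if i = j then 0 else 1 * a i"] no neg unfolding split by simp
        qed
      qed
    qed
  qed
  then show ?case by (auto simp: S'_def)
qed

lemma convex_contains_zero_complex:
  fixes S :: "('i \<Rightarrow> complex) set"
  assumes I: "finite I" and ne: "S \<noteq> {}"
    and conv: "\<And>x y t. x \<in> S \<Longrightarrow> y \<in> S \<Longrightarrow> 0 \<le> t \<Longrightarrow> t \<le> 1 \<Longrightarrow>
      (\<lambda>i. of_real (1 - t) * x i + of_real t * y i) \<in> S"
    and alt: "\<And>a. (\<exists>x\<in>S. 0 < Re (\<Sum>i\<in>I. a i * x i)) \<or> (\<forall>x\<in>S. Re (\<Sum>i\<in>I. a i * x i) = 0)"
  shows "\<exists>x\<in>S. \<forall>i\<in>I. x i = 0"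
proof -
  define \<rho> :: "('i \<Rightarrow> complex) \<Rightarrow> 'i \<times> bool \<Rightarrow> real"
    where "\<rho> x = (\<lambda>(i, c). if c then Re (x i) else Im (x i))" for x
  have "\<exists>y\<in>\<rho> ` S. \<forall>i\<in>I \<times> UNIV. y i = 0"
  proof (rule convex_contains_zero)
    show "finite (I \<times> (UNIV :: bool set))" using I by simp
    show "\<rho> ` S \<noteq> {}" using ne by simp
    fix x y :: "'i \<times> bool \<Rightarrow> real" and t :: real
    assume "x \<in> \<rho> ` S" "y \<in> \<rho> ` S" and t: "0 \<le> t" "t \<le> 1"
    then obtain x' y' where xy: "x' \<in> S" "x = \<rho> x'" "y' \<in> S" "y = \<rho> y'" by auto
    have "(\<lambda>i. (1 - t) * x i + t * y i) = \<rho> (\<lambda>i. of_real (1 - t) * x' i + of_real t * y' i)"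
      by (auto simp: xy \<rho>_def fun_eq_iff)
    then show "(\<lambda>i. (1 - t) * x i + t * y i) \<in> \<rho> ` S" using conv[OF xy(1,3) t] by simp
  next
    fix a :: "'i \<times> bool \<Rightarrow> real"
    have "(\<Sum>i\<in>I \<times> UNIV. a i * \<rho> x i) = Re (\<Sum>i\<in>I. Complex (a (i, True)) (- a (i, False)) * x i)" for x
      by (simp add: sum.cartesian_product[symmetric] UNIV_bool \<rho>_def sum.cartesian_product' add.commute)
    then show "(\<exists>x\<in>\<rho> ` S. 0 < (\<Sum>i\<in>I \<times> UNIV. a i * x i)) \<or> (\<forall>x\<in>\<rho> ` S. (\<Sum>i\<in>I \<times> UNIV. a i * x i) = 0)"
      using alt[of "\<lambda>i. Complex (a (i, True)) (- a (i, False))"] by auto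
  qed
  then obtain x where x: "x \<in> S" "\<forall>i\<in>I \<times> UNIV. \<rho> x i = 0" by blast
  have "x i = 0" if "i \<in> I" for i
    using x(2)[rule_format, of "(i, True)"] x(2)[rule_format, of "(i, False)"] that
    by (simp add: \<rho>_def complex_eq_iff)
  then show ?thesis using x(1) by blast
qed

section \<open>One-sided perturbations with prescribed transform values\<close>

lemma nonneg_integral_zero:
  fixes h :: "real \<Rightarrow> real"
  assumes c: "continuous_on {0..} h" and nn: "\<And>t. 0 \<le> t \<Longrightarrow> 0 \<le> h t"
    and i: "integrable half_line h" and z: "integral\<^sup>L half_line h \<le> 0" and t: "0 \<le> t"
  shows "h t = 0"
proof (rule ccontr)
  assume "h t \<noteq> 0"
  then have p: "0 < h t" using nn[OF t] by simp
  have "continuous (at t within {0..}) h" using c t by (simp add: continuous_on_eq_continuous_within)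
  then have "\<exists>d>0. \<forall>s\<in>{0..}. \<bar>s - t\<bar> < d \<longrightarrow> \<bar>h s - h t\<bar> < h t / 2"
    unfolding continuous_within_eps_delta dist_real_def using half_gt_zero[OF p] by blast
  then obtain d where d: "0 < d" "\<And>s. 0 \<le> s \<Longrightarrow> \<bar>s - t\<bar> < d \<Longrightarrow> \<bar>h s - h t\<bar> < h t / 2"
    by auto
  let ?I = "{t..t + d / 2}"
  have m: "emeasure half_line ?I = ennreal (d / 2)"
    using t d(1) by (subst emeasure_restrict_space) auto
  have s: "?I \<in> sets half_line" using t by (subst sets_restrict_space_iff) auto
  have "measure half_line ?I = d / 2" using m d(1) by (simp add: measure_def)
  then have "(\<integral>s. indicator ?I s * (h t / 2) \<partial>half_line) = d / 2 * (h t / 2)"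
    using s m t by (simp add: sets.Int_space_eq2 max_def)
  moreover have "(\<integral>s. indicator ?I s * (h t / 2) \<partial>half_line) \<le> integral\<^sup>L half_line h"
  proof (rule integral_mono[OF _ i])
    show "integrable half_line (\<lambda>s. indicator ?I s * (h t / 2))"
      using s m by (intro integrable_mult_left integrable_real_indicator) auto
    fix s assume "s \<in> space half_line"
    then have s: "0 \<le> s" by (simp add: space_restrict_space)
    show "indicator ?I s * (h t / 2) \<le> h s"
    proof (cases "s \<in> ?I")
      case True
      then have "\<bar>s - t\<bar> < d" using d(1) by auto
      then have "\<bar>h s - h t\<bar> < h t / 2" by (rule d(2)[OF s])
      then have "h t / 2 \<le> h s" by linarith
      then show ?thesis using True by simp
    qed (use nn[OF s] in simp)
  qed
  moreover have "0 < d / 2 * (h t / 2)" using d(1) p by simp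
  ultimately show False using z by linarith
qed

text \<open>
  Real parts are turned into sums over a conjugation-invariant set of points. For \<open>F s = exp (- s t)\<close>
  and for \<open>F\<close> a prescribed transform the same coefficients occur, so that vanishing coefficients of a
  real exponential sum carry over to the pairing with the prescribed values.
\<close>

lemma Re_sum_symmetric:
  fixes a F :: "complex \<Rightarrow> complex" and A :: "complex set"
  defines "a0 \<equiv> \<lambda>s. if s \<in> A then a s else 0"
  assumes A: "finite A" and F: "\<And>s. F (cnj s) = cnj (F s)"
  shows "of_real (Re (\<Sum>s\<in>A. a s * F s)) =
    (\<Sum>s\<in>A \<union> cnj ` A. (a0 s + cnj (a0 (cnj s))) / 2 * F s)"
proof -
  let ?B = "A \<union> cnj ` A"
  have B: "finite ?B" "cnj ` ?B = ?B" using A by (auto simp: image_Un image_image)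
  have 1: "(\<Sum>s\<in>A. a s * F s) = (\<Sum>s\<in>?B. a0 s * F s)"
    using B(1) by (intro sum.mono_neutral_cong_left) (auto simp: a0_def)
  have "cnj (\<Sum>s\<in>?B. a0 s * F s) = (\<Sum>s\<in>cnj ` ?B. cnj (a0 s) * cnj (F s))"
    unfolding B(2) by simp
  also have "\<dots> = (\<Sum>s\<in>?B. cnj (a0 (cnj s)) * F s)"
    by (subst sum.reindex) (auto simp: inj_on_def F)
  finally have 2: "cnj (\<Sum>s\<in>A. a s * F s) = (\<Sum>s\<in>?B. cnj (a0 (cnj s)) * F s)" unfolding 1 .
  have h: "of_real (Re z) = (z + cnj z) / 2" for z by (simp add: complex_add_cnj)
  have "of_real (Re (\<Sum>s\<in>A. a s * F s))
      = ((\<Sum>s\<in>?B. a0 s * F s) + (\<Sum>s\<in>?B. cnj (a0 (cnj s)) * F s)) / 2"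
    unfolding h 2 unfolding 1 ..
  then show ?thesis
    by (simp add: sum.distrib[symmetric] sum_divide_distrib ring_distribs add_divide_distrib)
qed

text \<open>
  The transform values at \<open>A\<close> of the admissible polynomials above the barrier \<open>\<beta>\<close> form a convex set.
  A functional that is bounded on that set by its value at the target \<open>g\<close> is integration against an
  exponential sum \<open>\<phi>\<close>. Large positive signals force \<open>\<phi> \<le> 0\<close>, so by Landau's argument \<open>\<phi>\<close> has no
  modes slower than \<open>\<gamma>\<close>. The remaining modes sit where the target vanishes, and small negative signals
  then force \<open>\<phi> = 0\<close>. Thus no functional separates the target.

  The hypothesis on \<open>\<beta>\<close> leaves room for a transient \<open>poly r 1 * exp (- (real k * t))\<close>, which brings
  the signal to its prescribed initial value \<open>poly r 1\<close>; as \<open>k\<close> grows, its transform tends to zero.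
\<close>

lemma one_sided_interpolation:
  fixes A :: "complex set" and g :: "complex \<Rightarrow> complex" and \<gamma> :: ereal
    and \<beta> :: "real \<Rightarrow> real" and k0 :: nat
  assumes A: "finite A" "\<And>s. s \<in> A \<Longrightarrow> 0 < Re s"
    and g: "\<And>s. g (cnj s) = cnj (g s)"
    and high: "\<And>s. s \<in> A \<Longrightarrow> \<gamma> \<le> ereal (Re s) \<Longrightarrow> g s = 0"
    and low: "\<And>s. s \<in> A \<Longrightarrow> ereal (Re s) < \<gamma> \<Longrightarrow> Im s \<noteq> 0"
    and r: "poly r 0 = 0"
    and \<eta>: "0 < \<eta>"
    and \<beta>: "\<And>k t. k0 \<le> k \<Longrightarrow> 0 \<le> t \<Longrightarrow> \<beta> t + \<eta> \<le> poly r 1 * exp (- (real k * t))"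
  obtains p where "poly p 0 = 0" "[:-1, 1:] ^ m dvd p - r"
    "\<And>t. 0 \<le> t \<Longrightarrow> \<beta> t \<le> poly p (exp (- t))"
    "\<And>s. s \<in> A \<Longrightarrow> rat_eval (exp_transform p) s = g s"
proof -
  define C where "C = {p. poly p 0 = 0 \<and> [:-1, 1:] ^ m dvd p - r \<and> (\<forall>t\<ge>0. \<beta> t \<le> poly p (exp (- t)))}"
  define T where "T p s = rat_eval (exp_transform p) s" for p s
  let ?c = "poly r 1"
  \<comment> \<open>Signals close to \<open>c e\<^bsup>-kt\<^esup> + h\<close> with \<open>h\<close> not far below zero are admissible.\<close>
  have approx: "\<exists>p\<in>C. \<forall>t\<ge>0. \<bar>poly p (exp (- t)) - (?c * exp (- (real k * t)) + h t)\<bar> \<le> \<delta>"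
    if k: "k0 \<le> k" "1 \<le> k" and h: "h \<in> C0" "h 0 = 0" "\<And>t. 0 \<le> t \<Longrightarrow> - (\<eta> / 2) \<le> h t"
      and \<delta>: "0 < \<delta>" "\<delta> \<le> \<eta> / 2" for k h \<delta>
  proof -
    let ?f = "\<lambda>t. ?c * exp (- (real k * t)) + h t"
    have "((\<lambda>t. exp (- (real k * t))) \<longlongrightarrow> 0) at_top" using k by real_asymp
    then have "(?f \<longlongrightarrow> ?c * 0 + 0) at_top"
      using h by (intro tendsto_intros) (auto simp: C0_def)
    then have "?f \<in> C0" using h by (auto simp: C0_def intro!: continuous_intros)
    moreover have "?f 0 = ?c" using h by simp
    ultimately obtain p where p: "poly p 0 = 0" "[:-1, 1:] ^ m dvd p - r"
        "\<And>t. 0 \<le> t \<Longrightarrow> \<bar>poly p (exp (- t)) - ?f t\<bar> \<le> \<delta>"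
      using poly_exp_dense[of ?f r \<delta> m] r \<delta> by blast
    have "\<beta> t \<le> poly p (exp (- t))" if "0 \<le> t" for t
      using p(3)[OF that] \<beta>[OF k(1) that] h(3)[OF that] \<delta> by linarith
    then show ?thesis using p by (auto simp: C_def)
  qed
  have "\<exists>x\<in>(\<lambda>p s. if s \<in> A then T p s - g s else 0) ` C. \<forall>s\<in>A. x s = 0"
  proof (rule convex_contains_zero_complex[OF A(1)])
    have "C \<noteq> {}" using approx[of "max 1 k0" "\<lambda>_. 0" "\<eta> / 2"] \<eta> by (auto simp: C0_def)
    then show "(\<lambda>p s. if s \<in> A then T p s - g s else 0) ` C \<noteq> {}" by simp
  next
    fix x y :: "complex \<Rightarrow> complex" and t :: real
    assume xy: "x \<in> (\<lambda>p s. if s \<in> A then T p s - g s else 0) ` C"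
      "y \<in> (\<lambda>p s. if s \<in> A then T p s - g s else 0) ` C" and t: "0 \<le> t" "t \<le> 1"
    then obtain p q where p: "p \<in> C" "x = (\<lambda>s. if s \<in> A then T p s - g s else 0)"
      and q: "q \<in> C" "y = (\<lambda>s. if s \<in> A then T q s - g s else 0)" by auto
    define u where "u = smult (1 - t) p + smult t q"
    have pq: "poly p 0 = 0" "poly q 0 = 0" using p(1) q(1) by (auto simp: C_def)
    have "u - r = smult (1 - t) (p - r) + smult t (q - r)"
      by (simp add: u_def smult_diff_right smult_diff_left)
    moreover have "[:-1, 1:] ^ m dvd smult (1 - t) (p - r) + smult t (q - r)"
      using p(1) q(1) by (intro dvd_add dvd_smult) (auto simp: C_def)
    moreover have "\<beta> s \<le> poly u (exp (- s))" if "0 \<le> s" for s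
    proof -
      have "(1 - t) * \<beta> s + t * \<beta> s \<le> (1 - t) * poly p (exp (- s)) + t * poly q (exp (- s))"
        using p(1) q(1) t that by (intro add_mono mult_left_mono) (auto simp: C_def)
      then show ?thesis by (simp add: u_def algebra_simps)
    qed
    ultimately have u: "u \<in> C" using pq by (simp add: C_def u_def)
    have const: "at.ge s 0 (const_rat c)" "rat_eval (const_rat c) s = of_real c" for c s
      using rat_eval_Fract[of 1 s "[:c:]"] by (simp_all add: map_poly_pCons)
    have "T u s = of_real (1 - t) * T p s + of_real t * T q s" if "s \<in> A" for s
    proof -
      have s: "0 \<le> Re s" using A(2)[OF that] by simp
      note reg = exp_transform_regular(1)[OF pq(1) s] exp_transform_regular(1)[OF pq(2) s]
      have "at.ge s (0 + 0) (const_rat (1 - t) * exp_transform p)" "at.ge s (0 + 0) (const_rat t * exp_transform q)"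
        by (rule at.ge_mult[OF const(1) reg(1)], rule at.ge_mult[OF const(1) reg(2)])
      then show ?thesis
        unfolding T_def u_def exp_transform_add exp_transform_smult
        by (simp only: add_0 rat_eval_add rat_eval_mult const reg)
    qed
    then have "(\<lambda>i. of_real (1 - t) * x i + of_real t * y i) = (\<lambda>s. if s \<in> A then T u s - g s else 0)"
      by (auto simp: p(2) q(2) fun_eq_iff algebra_simps)
    then show "(\<lambda>i. of_real (1 - t) * x i + of_real t * y i) \<in> (\<lambda>p s. if s \<in> A then T p s - g s else 0) ` C"
      using u by (intro image_eqI[where x = u]) simp_all
  next
    fix a :: "complex \<Rightarrow> complex"
    define \<phi> where "\<phi> t = Re (\<Sum>s\<in>A. a s * exp (- s * of_real t))" for t :: real
    define \<kappa> where "\<kappa> = Re (\<Sum>s\<in>A. a s * g s)"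
    define \<sigma> where "\<sigma> = Min (insert 1 (Re ` A))"
    define M where "M = (\<Sum>s\<in>A. norm (a s))"
    have \<sigma>: "0 < \<sigma>" "\<And>s. s \<in> A \<Longrightarrow> \<sigma> \<le> Re s" using A by (auto simp: \<sigma>_def)
    have M0: "0 \<le> M" by (auto simp: M_def intro: sum_nonneg)
    have \<phi>c: "continuous_on S \<phi>" for S unfolding \<phi>_def by (intro continuous_intros)
    have \<phi>b: "\<bar>\<phi> t\<bar> \<le> M * exp (- (\<sigma> * t))" if "0 \<le> t" for t
    proof -
      have "\<bar>\<phi> t\<bar> \<le> norm (\<Sum>s\<in>A. a s * exp (- s * of_real t))" unfolding \<phi>_def by (rule abs_Re_le_cmod)
      also have "\<dots> \<le> (\<Sum>s\<in>A. norm (a s) * exp (- (\<sigma> * t)))"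
        using \<sigma>(2) that
        by (intro sum_norm_le) (auto simp: norm_mult norm_exp_eq_Re intro!: mult_left_mono mult_right_mono)
      finally show ?thesis by (simp add: M_def sum_distrib_right)
    qed
    have \<phi>M: "\<bar>\<phi> t\<bar> \<le> M" if "0 \<le> t" for t
    proof -
      have "M * exp (- (\<sigma> * t)) \<le> M * 1" using M0 \<sigma>(1) that by (intro mult_left_mono) auto
      then show ?thesis using \<phi>b[OF that] by simp
    qed
    have \<phi>lim: "(\<phi> \<longlongrightarrow> 0) at_top"
    proof (rule Lim_null_comparison)
      show "\<forall>\<^sub>F t in at_top. norm (\<phi> t) \<le> M * exp (- (\<sigma> * t))"
        using eventually_ge_at_top[of 0] by eventually_elim (use \<phi>b in simp)
      show "((\<lambda>t. M * exp (- (\<sigma> * t))) \<longlongrightarrow> 0) at_top" using \<sigma>(1) by real_asymp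
    qed
    have int: "integrable half_line (\<lambda>t. f t * \<phi> t)" "\<bar>\<integral>t. f t * \<phi> t \<partial>half_line\<bar> \<le> D * M / \<sigma>"
      if f: "continuous_on {0..} f" "\<And>t. 0 \<le> t \<Longrightarrow> \<bar>f t\<bar> \<le> D" for f D
    proof -
      have m: "(\<lambda>t. f t * \<phi> t) \<in> borel_measurable half_line"
        using f(1) \<phi>c by (intro continuous_measurable_half_line continuous_intros)
      have b: "norm (f t * \<phi> t) \<le> D * M * exp (- (\<sigma> * t))" if "0 \<le> t" for t
      proof -
        have "0 \<le> D" using f(2)[OF that] by linarith
        then have "\<bar>f t\<bar> * \<bar>\<phi> t\<bar> \<le> D * (M * exp (- (\<sigma> * t)))"
          using f(2)[OF that] \<phi>b[OF that] by (intro mult_mono) auto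
        then show ?thesis by (simp add: abs_mult mult.assoc)
      qed
      show "integrable half_line (\<lambda>t. f t * \<phi> t)"
        by (rule integrable_half_line_bound(1)[OF m \<sigma>(1) b])
      show "\<bar>\<integral>t. f t * \<phi> t \<partial>half_line\<bar> \<le> D * M / \<sigma>"
        using integrable_half_line_bound(2)[OF m \<sigma>(1) b] unfolding real_norm_def .
    qed
    have pairing: "Re (\<Sum>s\<in>A. a s * T p s) = (\<integral>t. poly p (exp (- t)) * \<phi> t \<partial>half_line)"
      if "poly p 0 = 0" for p
    proof -
      let ?e = "\<lambda>s t. exp (- s * of_real t) * complex_of_real (poly p (exp (- t)))"
      have "(\<Sum>s\<in>A. a s * T p s) = (\<Sum>s\<in>A. \<integral>t. a s * ?e s t \<partial>half_line)"
        using laplace_poly_exp(2)[OF that] A(2) by (intro sum.cong refl) (simp add: T_def laplace_def)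
      also have "\<dots> = (\<integral>t. (\<Sum>s\<in>A. a s * ?e s t) \<partial>half_line)"
        using laplace_poly_exp(1)[OF that] A(2)
        by (intro Bochner_Integration.integral_sum[symmetric] integrable_mult_right) auto
      also have "Re \<dots> = (\<integral>t. Re (\<Sum>s\<in>A. a s * ?e s t) \<partial>half_line)"
        using laplace_poly_exp(1)[OF that] A(2)
        by (intro integral_Re[symmetric] Bochner_Integration.integrable_sum integrable_mult_right) auto
      also have "\<dots> = (\<integral>t. poly p (exp (- t)) * \<phi> t \<partial>half_line)"
      proof (intro Bochner_Integration.integral_cong refl)
        fix t
        have "(\<Sum>s\<in>A. a s * ?e s t) = of_real (poly p (exp (- t))) * (\<Sum>s\<in>A. a s * exp (- s * of_real t))"
          by (simp add: sum_distrib_left mult_ac)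
        then show "Re (\<Sum>s\<in>A. a s * ?e s t) = poly p (exp (- t)) * \<phi> t" by (simp add: \<phi>_def)
      qed
      finally show ?thesis .
    qed
    have gap: "Re (\<Sum>s\<in>A. a s * (T p s - g s)) = (\<integral>t. poly p (exp (- t)) * \<phi> t \<partial>half_line) - \<kappa>"
      if "p \<in> C" for p
      using pairing[of p] that by (simp add: \<kappa>_def C_def right_diff_distrib sum_subtractf)
    have "(\<exists>p\<in>C. 0 < Re (\<Sum>s\<in>A. a s * (T p s - g s))) \<or> (\<forall>p\<in>C. Re (\<Sum>s\<in>A. a s * (T p s - g s)) = 0)"
    proof (subst disj_commute, rule disjCI)
      assume "\<not> (\<exists>p\<in>C. 0 < Re (\<Sum>s\<in>A. a s * (T p s - g s)))"
      then have sep: "(\<integral>t. poly p (exp (- t)) * \<phi> t \<partial>half_line) \<le> \<kappa>" if "p \<in> C" for p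
        using gap[OF that] that by force
      \<comment> \<open>The transient contributes at most \<open>\<bar>c\<bar> M / k\<close> to the pairing, so it disappears in the limit.\<close>
      have test: "(\<integral>t. h t * \<phi> t \<partial>half_line) \<le> \<kappa>"
        if h: "h \<in> C0" "h 0 = 0" "\<And>t. 0 \<le> t \<Longrightarrow> - (\<eta> / 2) \<le> h t" for h
      proof (rule field_le_epsilon)
        fix \<epsilon> :: real assume \<epsilon>: "0 < \<epsilon>"
        define X where "X = M / \<sigma> + 1"
        have X: "0 < X" "M / \<sigma> \<le> X" using M0 \<sigma>(1) by (simp_all add: X_def add_nonneg_pos)
        define \<delta> where "\<delta> = min (\<eta> / 2) (\<epsilon> / 2 / X)"
        have \<delta>: "0 < \<delta>" using \<eta> \<epsilon> X(1) by (simp add: \<delta>_def)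
        have \<delta>_le: "\<delta> \<le> \<eta> / 2" "\<delta> \<le> \<epsilon> / 2 / X"
          unfolding \<delta>_def by (rule min.cobounded1, rule min.cobounded2)
        have "\<delta> * (M / \<sigma>) \<le> \<delta> * X" using \<delta> X(2) by (intro mult_left_mono) auto
        also have "\<dots> \<le> \<epsilon> / 2 / X * X" using X(1) \<delta>_le(2) by (intro mult_right_mono) auto
        also have "\<dots> = \<epsilon> / 2" using X(1) by simp
        finally have \<delta>': "\<delta> * M / \<sigma> \<le> \<epsilon> / 2" by (simp only: times_divide_eq_right)
        obtain k1 :: nat where k1: "\<bar>?c\<bar> * M / (\<epsilon> / 2) < real k1" using reals_Archimedean2 by blast
        define k where "k = max 1 (max k0 k1)"
        have k: "k0 \<le> k" "1 \<le> k" "real k1 \<le> real k" by (auto simp: k_def)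
        have "\<bar>?c\<bar> * M < \<epsilon> / 2 * real k1" using k1 \<epsilon> by (simp add: field_simps)
        also have "\<dots> \<le> \<epsilon> / 2 * real k" using k \<epsilon> by (intro mult_left_mono) auto
        finally have k': "\<bar>?c\<bar> * M / real k \<le> \<epsilon> / 2" using k(2) by (simp add: field_simps)
        let ?e = "\<lambda>t. ?c * exp (- (real k * t))"
        obtain p where p: "p \<in> C" "\<And>t. 0 \<le> t \<Longrightarrow> \<bar>poly p (exp (- t)) - (?e t + h t)\<bar> \<le> \<delta>"
          using approx[OF k(1,2) h \<delta> \<delta>_le(1)] by blast
        let ?d = "\<lambda>t. poly p (exp (- t)) - (?e t + h t)"
        have hc: "continuous_on {0..} h" using h(1) by (simp add: C0_def)
        obtain H where H: "\<And>t. 0 \<le> t \<Longrightarrow> \<bar>h t\<bar> \<le> H" using C0_bounded[OF h(1)] by blast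
        have dc: "continuous_on {0..} ?d" using hc by (intro continuous_intros)
        have eb: "\<bar>?e t\<bar> \<le> \<bar>?c\<bar>" if "0 \<le> t" for t
          using that by (simp add: abs_mult mult_left_le)
        have ec: "continuous_on {0..} ?e" by (intro continuous_intros)
        note Ih = int(1)[OF hc H] and Id = int[OF dc p(2)] and Ie = int(1)[OF ec eb]
        have "\<bar>\<integral>t. ?e t * \<phi> t \<partial>half_line\<bar> \<le> \<bar>?c\<bar> * M / real k"
        proof -
          have m: "(\<lambda>t. ?e t * \<phi> t) \<in> borel_measurable half_line"
            using \<phi>c by (intro continuous_measurable_half_line continuous_intros)
          have "norm (?e t * \<phi> t) \<le> \<bar>?c\<bar> * M * exp (- (real k * t))" if "0 \<le> t" for t
            using mult_right_mono[OF \<phi>M[OF that], of "\<bar>?c\<bar> * exp (- (real k * t))"]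
            by (simp add: abs_mult mult_ac)
          then show ?thesis using integrable_half_line_bound(2)[OF m, of "real k" "\<bar>?c\<bar> * M"] k(2) by simp
        qed
        moreover have "(\<integral>t. poly p (exp (- t)) * \<phi> t \<partial>half_line) =
            (\<integral>t. (?d t * \<phi> t + ?e t * \<phi> t) + h t * \<phi> t \<partial>half_line)"
          by (intro Bochner_Integration.integral_cong refl) (simp add: algebra_simps)
        moreover have "\<dots> = ((\<integral>t. ?d t * \<phi> t \<partial>half_line) + (\<integral>t. ?e t * \<phi> t \<partial>half_line)) + (\<integral>t. h t * \<phi> t \<partial>half_line)"
          using Ih Id(1) Ie by (subst Bochner_Integration.integral_add; (intro Bochner_Integration.integrable_add)?)+ auto
        ultimately show "(\<integral>t. h t * \<phi> t \<partial>half_line) \<le> \<kappa> + \<epsilon>"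
          using sep[OF p(1)] Id(2) \<delta>' k' by linarith
      qed
      have weight: "(\<lambda>t. (1 - exp (- t)) * f t) \<in> C0" if "f \<in> C0" for f
      proof -
        have "((\<lambda>t. (1 - exp (- t)) * f t) \<longlongrightarrow> (1 - 0) * 0) at_top"
          using that by (intro tendsto_intros filterlim_compose[OF exp_at_bot] filterlim_uminus_at_bot_at_top)
            (auto simp: C0_def)
        then show ?thesis using that by (auto simp: C0_def intro!: continuous_intros)
      qed
      have \<phi>C0: "\<phi> \<in> C0" using \<phi>c \<phi>lim by (simp add: C0_def)
      have C0_scale: "(\<lambda>t. c * f t) \<in> C0" if "f \<in> C0" for c f
        using that by (auto simp: C0_def intro!: continuous_intros tendsto_mult_right_zero)
      have at_0: "f 0 \<le> 0" if "continuous_on UNIV f" "\<And>t. 0 < t \<Longrightarrow> f t \<le> 0" for f :: "real \<Rightarrow> real"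
      proof (rule tendsto_upperbound)
        show "(f \<longlongrightarrow> f 0) (at_right 0)"
          using that(1) by (auto simp: continuous_on_def intro: tendsto_within_subset)
        show "\<forall>\<^sub>F t in at_right 0. f t \<le> 0"
          using eventually_at_right_less[of 0] by eventually_elim (rule that(2))
      qed simp
      \<comment> \<open>Test with large multiples of the positive part of \<open>\<phi>\<close>. The weight \<open>1 - exp (- t)\<close> makes the
        test signal start at zero.\<close>
      have unbounded: "J \<le> 0" if "\<And>L. 0 \<le> L \<Longrightarrow> L * J \<le> \<kappa>" for J :: real
      proof (rule ccontr)
        assume "\<not> J \<le> 0"
        then show False using that[of "(\<bar>\<kappa>\<bar> + 1) / J"] by simp
      qed
      have \<phi>_le: "\<phi> t \<le> 0" if t: "0 \<le> t" for t
      proof -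
        let ?h = "\<lambda>t. (1 - exp (- t)) * max 0 (\<phi> t)"
        have "((\<lambda>t. max 0 (\<phi> t)) \<longlongrightarrow> max 0 0) at_top" using \<phi>lim by (intro tendsto_intros)
        then have "(\<lambda>t. max 0 (\<phi> t)) \<in> C0" using \<phi>c by (auto simp: C0_def intro!: continuous_intros)
        then have hC: "?h \<in> C0" by (rule weight)
        then have hc: "continuous_on {0..} ?h" by (simp add: C0_def)
        obtain H where H: "\<And>t. 0 \<le> t \<Longrightarrow> \<bar>?h t\<bar> \<le> H" using C0_bounded[OF hC] by blast
        have h0: "0 \<le> ?h t" if "0 \<le> t" for t using that by simp
        let ?J = "\<integral>t. ?h t * \<phi> t \<partial>half_line"
        have "L * ?J \<le> \<kappa>" if "0 \<le> L" for L
        proof -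
          have "(\<integral>t. (L * ?h t) * \<phi> t \<partial>half_line) \<le> \<kappa>"
          proof (rule test)
            show "(\<lambda>t. L * ?h t) \<in> C0" using C0_scale[OF hC] .
            show "- (\<eta> / 2) \<le> L * ?h t" if "0 \<le> t" for t
              using mult_nonneg_nonneg[OF \<open>0 \<le> L\<close> h0[OF that]] \<eta> by linarith
          qed simp
          moreover have "(\<integral>t. (L * ?h t) * \<phi> t \<partial>half_line) = L * ?J"
            by (simp only: mult.assoc integral_mult_right_zero)
          ultimately show ?thesis by simp
        qed
        then have J: "?J \<le> 0" by (rule unbounded)
        have z: "?h t * \<phi> t = 0" if "0 \<le> t" for t
        proof (rule nonneg_integral_zero[OF _ _ int(1)[OF hc H] J that])
          show "continuous_on {0..} (\<lambda>t. ?h t * \<phi> t)" using hc \<phi>c by (intro continuous_intros)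
          show "0 \<le> ?h t * \<phi> t" if "0 \<le> t" for t
            using that by (cases "0 \<le> \<phi> t") (auto simp: max_def)
        qed
        have pos: "\<phi> t \<le> 0" if "0 < t" for t
          using z[of t] that by (auto simp: max_def split: if_splits)
        show ?thesis using pos[of t] at_0[OF \<phi>c pos] t by (cases "t = 0") auto
      qed
      let ?a0 = "\<lambda>s. if s \<in> A then a s else 0"
      define b where "b s = (?a0 s + cnj (?a0 (cnj s))) / 2" for s
      define B where "B = {s \<in> A \<union> cnj ` A. b s \<noteq> 0}"
      have B: "finite B" using A(1) by (simp add: B_def)
      have symm: "of_real (Re (\<Sum>s\<in>A. a s * F s)) = (\<Sum>s\<in>B. b s * F s)"
        if "\<And>s. F (cnj s) = cnj (F s)" for F
      proof -
        have "(\<Sum>s\<in>B. b s * F s) = (\<Sum>s\<in>A \<union> cnj ` A. b s * F s)"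
          using A(1) by (intro sum.mono_neutral_left) (auto simp: B_def)
        then show ?thesis using Re_sum_symmetric[where F = F and A = A and a = a, OF A(1)] that by (simp add: b_def)
      qed
      have \<phi>B: "(\<Sum>s\<in>B. b s * exp (- s * of_real t)) = of_real (\<phi> t)" for t
        unfolding \<phi>_def by (rule symm[symmetric]) (simp add: exp_cnj)
      have fast: "\<gamma> \<le> ereal (Re s)" if s: "s \<in> B" for s
      proof (rule ccontr)
        assume less: "\<not> \<gamma> \<le> ereal (Re s)"
        obtain s0 where s0: "s0 \<in> B" "\<And>s. s \<in> B \<Longrightarrow> Re s0 \<le> Re s"
          using ex_min_if_finite[of "Re ` B"] B s by (fastforce simp: not_less)
        have "\<exists>s\<in>B. Re s = Re s0 \<and> Im s = 0"
        proof (rule slowest_mode_real[OF B _ _ s0])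
          show "\<exists>r\<le>0. (\<Sum>s\<in>B. b s * exp (- s * of_real t)) = of_real r" if "0 \<le> t" for t
            using \<phi>B \<phi>_le[OF that] by blast
        qed (auto simp: B_def)
        then obtain s1 where s1: "s1 \<in> B" "Re s1 = Re s0" "Im s1 = 0" by blast
        have "cnj s1 = s1" using s1(3) by (simp add: complex_eq_iff)
        then have "s1 \<in> A" using s1(1) by (auto simp: B_def)
        moreover have "ereal (Re s1) < \<gamma>"
          using less s0(2)[OF s] s1(2) by (simp add: not_le) (meson ereal_less_eq(3) le_less_trans)
        ultimately show False using low s1(3) by blast
      qed
      have "complex_of_real \<kappa> = (\<Sum>s\<in>B. b s * g s)" unfolding \<kappa>_def by (rule symm) (rule g)
      also have "\<dots> = 0"
      proof (rule sum.neutral, rule ballI)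
        fix s assume s: "s \<in> B"
        then consider "s \<in> A" | "cnj s \<in> A" by (auto simp: B_def)
        then have "g s = 0"
        proof cases
          case 2
          then have "g (cnj s) = 0" using high[OF 2] fast[OF s] by simp
          then show ?thesis by (simp add: g)
        qed (use high fast[OF s] in blast)
        then show "b s * g s = 0" by simp
      qed
      finally have \<kappa>: "\<kappa> = 0" by simp
      \<comment> \<open>Now test with \<open>\<phi>\<close> itself, scaled so as to stay above \<open>- \<eta> / 2\<close>.\<close>
      have \<phi>0: "\<phi> t = 0" if t: "0 \<le> t" for t
      proof -
        define L where "L = \<eta> / (2 * (M + 1))"
        have L: "0 < L" "L * M \<le> \<eta> / 2" using \<eta> M0 by (auto simp: L_def field_simps)
        let ?h = "\<lambda>t. L * ((1 - exp (- t)) * \<phi> t)"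
        have hC: "?h \<in> C0" by (intro C0_scale weight \<phi>C0)
        then have hc: "continuous_on {0..} ?h" by (simp add: C0_def)
        obtain H where H: "\<And>t. 0 \<le> t \<Longrightarrow> \<bar>?h t\<bar> \<le> H" using C0_bounded[OF hC] by blast
        have "(\<integral>t. ?h t * \<phi> t \<partial>half_line) \<le> \<kappa>"
        proof (rule test[OF hC])
          show "- (\<eta> / 2) \<le> ?h t" if "0 \<le> t" for t
          proof -
            have "\<bar>?h t\<bar> \<le> L * (1 * M)"
              unfolding abs_mult using L(1) M0 \<phi>M[OF that] that
              by (intro mult_mono) auto
            then show ?thesis using L(2) by linarith
          qed
        qed simp
        then have J: "(\<integral>t. ?h t * \<phi> t \<partial>half_line) \<le> 0" unfolding \<kappa> .
        have z: "?h t * \<phi> t = 0" if "0 \<le> t" for t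
        proof (rule nonneg_integral_zero[OF _ _ int(1)[OF hc H] J that])
          show "continuous_on {0..} (\<lambda>t. ?h t * \<phi> t)" using hc \<phi>c by (intro continuous_intros)
          show "0 \<le> ?h t * \<phi> t" if "0 \<le> t" for t
            using that L(1) by (simp add: mult.assoc)
        qed
        have pos: "\<phi> t = 0" if "0 < t" for t
          using z[of t] that L(1) by auto
        have "- \<phi> 0 \<le> 0"
        proof (rule at_0[of "\<lambda>t. - \<phi> t"])
          show "continuous_on UNIV (\<lambda>t. - \<phi> t)" by (rule continuous_on_minus[OF \<phi>c])
        qed (simp add: pos)
        then show ?thesis using pos[of t] \<phi>_le[of 0] t by (cases "t = 0") auto
      qed
      show "\<forall>p\<in>C. Re (\<Sum>s\<in>A. a s * (T p s - g s)) = 0"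
      proof
        fix p assume p: "p \<in> C"
        have "(\<integral>t. poly p (exp (- t)) * \<phi> t \<partial>half_line) = (\<integral>t. 0 \<partial>half_line)"
          by (intro Bochner_Integration.integral_cong refl) (simp add: \<phi>0 space_restrict_space)
        then show "Re (\<Sum>s\<in>A. a s * (T p s - g s)) = 0" using gap[OF p] \<kappa> by simp
      qed
    qed
    moreover have "(\<Sum>s\<in>A. a s * (if s \<in> A then T p s - g s else 0)) = (\<Sum>s\<in>A. a s * (T p s - g s))" for p
      by (intro sum.cong) auto
    ultimately show "(\<exists>x\<in>(\<lambda>p s. if s \<in> A then T p s - g s else 0) ` C. 0 < Re (\<Sum>i\<in>A. a i * x i)) \<or>
        (\<forall>x\<in>(\<lambda>p s. if s \<in> A then T p s - g s else 0) ` C. Re (\<Sum>i\<in>A. a i * x i) = 0)"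
      by simp
  qed
  then obtain p where p: "p \<in> C" "\<And>s. s \<in> A \<Longrightarrow> T p s - g s = 0" by auto
  show ?thesis
    by (rule that[of p]) (use p in \<open>auto simp: C_def T_def\<close>)
qed

section \<open>Achievable error signals\<close>

lemma plant_val:
  assumes "plant P"
  shows "P \<noteq> 0" and "0 \<le> inf.val P"
    and "0 \<le> Re s \<Longrightarrow> \<bar>at.val s P\<bar> \<le> 1"
    and "0 \<le> Re s \<Longrightarrow> at.val s P \<noteq> 0 \<Longrightarrow> 0 < Re s \<and> (is_zero_of P s \<or> is_pole_of P s)"
proof -
  obtain k where k: "zero_at_infinity P k" using assms by (auto simp: plant_def)
  then show P: "P \<noteq> 0" and "0 \<le> inf.val P" by (auto simp: zero_at_infinity_iff)
  have z: "order s (cpoly (rnum P)) = 0 \<longleftrightarrow> \<not> is_zero_of P s"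
    using order_eq_0_iff[of "cpoly (rnum P)" s] P by (simp add: is_zero_of_def)
  have p: "order s (cpoly (rden P)) = 0 \<longleftrightarrow> \<not> is_pole_of P s"
    using order_eq_0_iff[of "cpoly (rden P)" s] by (simp add: is_pole_of_def)
  assume s: "0 \<le> Re s"
  have Z: "is_zero_of P s \<Longrightarrow> order s (cpoly (rnum P)) = 1 \<and> \<not> is_pole_of P s \<and> Re s \<noteq> 0"
    and Q: "is_pole_of P s \<Longrightarrow> order s (cpoly (rden P)) = 1 \<and> \<not> is_zero_of P s \<and> Re s \<noteq> 0"
    using assms s by (auto simp: plant_def)
  show "\<bar>at.val s P\<bar> \<le> 1" using Z Q z p unfolding at.val_def by (cases "is_zero_of P s"; cases "is_pole_of P s") auto
  show "0 < Re s \<and> (is_zero_of P s \<or> is_pole_of P s)" if "at.val s P \<noteq> 0"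
    using that Z Q z p s unfolding at.val_def by (cases "is_zero_of P s"; cases "is_pole_of P s") auto
qed

text \<open>
  The sensitivity \<open>S = d (v - q n)\<close> vanishes with \<open>d\<close>, and \<open>1 - S = n (x + q d)\<close> vanishes with \<open>n\<close>,
  at infinity as well as at finite points.
\<close>

lemma error_signal_sensitivity:
  assumes "e \<in> error_signals W P" "P \<noteq> 0" "0 \<le> inf.val P"
  obtains S where "has_laplace e (W * S)" "inf.ge 0 S" "inf.ge (inf.val P) (1 - S)"
    "\<And>s. 0 \<le> Re s \<Longrightarrow> at.ge s 0 (W * S)"
    "\<And>s. 0 \<le> Re s \<Longrightarrow> is_zero_of P s \<Longrightarrow> at.ge s 1 (1 - S)"
    "\<And>s. 0 \<le> Re s \<Longrightarrow> is_pole_of P s \<Longrightarrow> at.ge s 1 S"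
proof -
  obtain n d x v q where b: "bezout_factorization P n d x v" and q: "q \<in> stable_ratfuns"
    and e: "has_laplace e (W * d * (v - q * n))" and eC: "e \<in> C0"
    using assms(1) by (auto simp: error_signals_def)
  have st: "n \<in> stable_ratfuns" "d \<in> stable_ratfuns" "x \<in> stable_ratfuns" "v \<in> stable_ratfuns"
    and dnz: "d \<noteq> 0" and P: "P = n / d" and bez: "x * n + v * d = 1"
    using b by (auto simp: bezout_factorization_def)
  have nnz: "n \<noteq> 0" using P assms(2) by auto
  define S where "S = d * (v - q * n)"
  have S1: "1 - S = n * (x + q * d)" unfolding S_def bez[symmetric] by (simp add: algebra_simps)
  have WS: "W * S = W * d * (v - q * n)" by (simp add: S_def mult.assoc)
  have infs: "inf.ge 0 n" "inf.ge 0 d" "inf.ge 0 x" "inf.ge 0 v" "inf.ge 0 q"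
    using st q by (simp_all add: stable_iff)
  have ats: "at.ge s 0 n" "at.ge s 0 d" "at.ge s 0 x" "at.ge s 0 v" "at.ge s 0 q" if "0 \<le> Re s" for s
    using st q that by (simp_all add: stable_iff)
  have "inf.ge (0 + 0) (q * n)" "inf.ge (0 + 0) (q * d)" using infs by (intro inf.ge_mult; simp)+
  then have i: "inf.ge 0 (v - q * n)" "inf.ge 0 (x + q * d)"
    using infs by (auto intro: inf.ge_diff inf.ge_add)
  show ?thesis
  proof (rule that[of S])
    show "has_laplace e (W * S)" using e by (simp add: WS)
    then show "\<And>s. 0 \<le> Re s \<Longrightarrow> at.ge s 0 (W * S)" using C0_laplace_no_poles[OF eC] by blast
    show "inf.ge 0 S" using inf.ge_mult[OF infs(2) i(1)] by (simp add: S_def)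
    have "inf.ge (inf.val P) n"
      using inf.val_bezout(1)[OF infs(1-4) bez nnz dnz] assms(3) P by (simp add: inf.ge_def)
    then show "inf.ge (inf.val P) (1 - S)" using inf.ge_mult[OF _ i(2)] S1 by fastforce
    fix s :: complex assume s: "0 \<le> Re s"
    note a = ats[OF s]
    have "at.ge s (0 + 0) (q * n)" "at.ge s (0 + 0) (q * d)" using a by (intro at.ge_mult; simp)+
    then have j: "at.ge s 0 (v - q * n)" "at.ge s 0 (x + q * d)"
      using a by (auto intro: at.ge_diff at.ge_add)
    show "at.ge s 1 (1 - S)" if "is_zero_of P s"
    proof -
      have "1 \<le> at.val s P" using that assms(2) by (simp add: zero_iff at.ge_def)
      then have "at.ge s 1 n"
        using at.val_bezout(1)[OF a(1-4) bez nnz dnz] P by (simp add: at.ge_def)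
      then have "at.ge s (1 + 0) (n * (x + q * d))" using j(2) by (rule at.ge_mult)
      then show ?thesis by (simp add: S1)
    qed
    show "at.ge s 1 S" if "is_pole_of P s"
    proof -
      have "at.val s P \<le> -1" using that assms(2) not_pole_iff[of P s] by (simp add: at.ge_def)
      then have "at.ge s 1 d"
        using at.val_bezout(2)[OF a(1-4) bez nnz dnz] P by (simp add: at.ge_def)
      then have "at.ge s (1 + 0) (d * (v - q * n))" using j(1) by (rule at.ge_mult)
      then show ?thesis by (simp add: S_def)
    qed
  qed
qed

text \<open>
  Adding \<open>f\<close> changes the free parameter by \<open>- D / (W d n)\<close>. At each place at most one of \<open>n\<close> and
  \<open>d\<close> is a non-unit, so the denominator has valuation \<open>val W + \<bar>val P\<bar>\<close>.
\<close>

lemma error_signals_perturb: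
  assumes e: "e \<in> error_signals W P" and nz: "P \<noteq> 0" "W \<noteq> 0"
    and f: "f \<in> C0" "has_laplace f D"
    and inf: "inf.ge (inf.val W + \<bar>inf.val P\<bar>) D"
    and at: "\<And>s. 0 \<le> Re s \<Longrightarrow> at.ge s (at.val s W + \<bar>at.val s P\<bar>) D"
  shows "(\<lambda>t. e t + f t) \<in> error_signals W P"
proof -
  obtain n d x v q where b: "bezout_factorization P n d x v" and q: "q \<in> stable_ratfuns"
    and el: "has_laplace e (W * d * (v - q * n))" and eC: "e \<in> C0"
    using e by (auto simp: error_signals_def)
  have st: "n \<in> stable_ratfuns" "d \<in> stable_ratfuns" "x \<in> stable_ratfuns" "v \<in> stable_ratfuns"
    and dnz: "d \<noteq> 0" and P: "P = n / d" and bez: "x * n + v * d = 1"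
    using b by (auto simp: bezout_factorization_def)
  have nnz: "n \<noteq> 0" using P nz by auto
  define q' where "q' = q - D / (W * d * n)"
  have "inf.ge 0 (D / (W * d * n))"
  proof (cases "D = 0")
    case False
    have "inf.val n + inf.val d = \<bar>inf.val P\<bar>"
      using inf.val_bezout[OF _ _ _ _ bez nnz dnz] st P by (simp add: stable_iff)
    then show ?thesis using inf False nz nnz dnz
      by (simp add: inf.ge_def inf.val_divide inf.val_mult)
  qed simp
  moreover have "at.ge s 0 (D / (W * d * n))" if s: "0 \<le> Re s" for s
  proof (cases "D = 0")
    case False
    have "at.val s n + at.val s d = \<bar>at.val s P\<bar>"
      using at.val_bezout[OF _ _ _ _ bez nnz dnz] st s P by (simp add: stable_iff)
    then show ?thesis using at[OF s] False nz nnz dnz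
      by (simp add: at.ge_def at.val_divide at.val_mult)
  qed simp
  ultimately have "q' \<in> stable_ratfuns"
    using q unfolding stable_iff q'_def by (auto intro: inf.ge_diff at.ge_diff)
  moreover have "W * d * (v - q' * n) = W * d * (v - q * n) + D"
  proof -
    have "W * d * (v - q' * n) = W * d * (v - q * n) + (W * d * n) * (D / (W * d * n))"
      by (simp only: q'_def algebra_simps)
    then show ?thesis using nz nnz dnz by simp
  qed
  then have "has_laplace (\<lambda>t. e t + f t) (W * d * (v - q' * n))"
    using has_laplace_add[OF el f(2)] by simp
  moreover have "(\<lambda>t. e t + f t) \<in> C0"
    using eC f(1) by (auto simp: C0_def intro!: continuous_intros tendsto_add_zero)
  ultimately show ?thesis using b unfolding error_signals_def by blast
qed

text \<open>
  A negative transient is harmless: it is over before \<open>y\<close> has left the vicinity of \<open>y 0 \<ge> - c\<close>.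
\<close>

lemma dominated_by_barrier:
  fixes c \<epsilon> :: real and y :: "real \<Rightarrow> real"
  assumes y: "continuous_on {0..} y" and c: "0 \<le> c \<or> - c \<le> y 0" and \<epsilon>: "0 < \<epsilon>"
  shows "\<exists>k0. \<forall>k t. k0 \<le> k \<longrightarrow> 0 \<le> t \<longrightarrow> - max (y t) 0 - \<epsilon> \<le> c * exp (- (real k * t))"
proof (cases "0 \<le> c")
  case True
  have "- max (y t) 0 - \<epsilon> \<le> c * exp (- (real k * t))" for k t
  proof -
    have "0 \<le> c * exp (- (real k * t))" using True by simp
    then show ?thesis using \<epsilon> max.cobounded2[of 0 "y t"] by linarith
  qed
  then show ?thesis by blast
next
  case False
  have "continuous (at 0 within {0..}) y" using y by (simp add: continuous_on_eq_continuous_within)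
  then have "\<exists>d>0. \<forall>t\<in>{0..}. \<bar>t - 0\<bar> < d \<longrightarrow> \<bar>y t - y 0\<bar> < \<epsilon>"
    unfolding continuous_within_eps_delta dist_real_def using \<epsilon> by blast
  then obtain d where d: "0 < d" "\<And>t. 0 \<le> t \<Longrightarrow> t < d \<Longrightarrow> \<bar>y t - y 0\<bar> < \<epsilon>" by auto
  have "(\<lambda>k. - c * exp (- (real k * d))) \<longlonglongrightarrow> 0" using d(1) by real_asymp
  from order_tendstoD(2)[OF this \<epsilon>]
  obtain k0 where k0: "\<And>k. k0 \<le> k \<Longrightarrow> - c * exp (- (real k * d)) < \<epsilon>"
    by (auto simp: eventually_sequentially)
  show ?thesis
  proof (intro exI allI impI)
    fix k :: nat and t :: real assume k: "k0 \<le> k" and t: "0 \<le> t"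
    show "- max (y t) 0 - \<epsilon> \<le> c * exp (- (real k * t))"
    proof (cases "t < d")
      case True
      have "- c * exp (- (real k * t)) \<le> - c * 1" using False t by (intro mult_left_mono) auto
      then show ?thesis using d(2)[OF t True] False c by linarith
    next
      case False': False
      have "real k * d \<le> real k * t" using False' by (intro mult_left_mono) auto
      then have "- c * exp (- (real k * t)) \<le> - c * exp (- (real k * d))"
        using False by (intro mult_left_mono) auto
      then show ?thesis using k0[OF k] by linarith
    qed
  qed
qed

text \<open>
  Let \<open>e\<^sub>0\<close> be achievable for \<open>P'\<close>. The transform of \<open>e\<^sub>0 - e\<close> vanishes at the common poles and
  zeros with \<open>Re s \<ge> \<gamma>\<close>, unless \<open>W\<close> has a pole there. So a one-sided perturbation of \<open>e\<close> can imitate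
  \<open>e\<^sub>0 - e\<close> at the poles and zeros of \<open>P'\<close> and to the required order at infinity, and by
  \<open>error_signals_perturb\<close> the result is achievable for \<open>P'\<close>. Poles of \<open>W\<close> are left out: since \<open>W\<close>
  has no zeros to cancel, \<open>1 / W\<close> vanishes there and supplies the simple zero that is required.

  The sign \<open>\<sigma>\<close> treats upward and downward perturbations together. The perturbation may be as low
  as \<open>- y\<close> where \<open>y\<close> is positive, which leaves room for an initial jump of \<open>e\<close> to \<open>w 0\<close> when \<open>P'\<close> is
  strictly proper and \<open>P\<close> is not.
\<close>

lemma transfer_error_signal:
  fixes \<sigma> \<epsilon> :: real and y :: "real \<Rightarrow> real"
  assumes w: "reference_input w W" "minimum_phase W"
    and P: "P \<in> plant_class \<gamma> Z Q" and P': "P' \<in> plant_class \<gamma> Z Q"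
    and e: "e \<in> error_signals W P" and ne: "error_signals W P' \<noteq> {}"
    and \<sigma>: "\<sigma> = 1 \<or> \<sigma> = -1" and \<epsilon>: "0 < \<epsilon>"
    and y: "continuous_on {0..} y"
    and start: "zero_at_infinity P 0 \<Longrightarrow> \<not> zero_at_infinity P' 0 \<Longrightarrow>
      0 \<le> \<sigma> * (w 0 - e 0) \<or> - (\<sigma> * (w 0 - e 0)) \<le> y 0"
  shows "\<exists>e'\<in>error_signals W P'. \<forall>t\<ge>0. - max (y t) 0 - \<epsilon> \<le> \<sigma> * (e' t - e t)"
proof -
  obtain e0 where e0: "e0 \<in> error_signals W P'" using ne by blast
  have pl: "plant P" "plant P'" using P P' by (auto simp: plant_class_def)
  note v = plant_val[OF pl(1)] and v' = plant_val[OF pl(2)]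
  obtain kw where kw: "1 \<le> kw" "W \<noteq> 0" "inf.val W = int kw"
    using w(1) by (auto simp: reference_input_def zero_at_infinity_iff)
  have wc: "continuous_on {0..} w" and wl: "has_laplace w W"
    using w(1) by (auto simp: reference_input_def)
  obtain S where S: "has_laplace e (W * S)" "inf.ge 0 S" "inf.ge (inf.val P) (1 - S)"
      "\<And>s. 0 \<le> Re s \<Longrightarrow> at.ge s 0 (W * S)"
      "\<And>s. 0 \<le> Re s \<Longrightarrow> is_zero_of P s \<Longrightarrow> at.ge s 1 (1 - S)"
      "\<And>s. 0 \<le> Re s \<Longrightarrow> is_pole_of P s \<Longrightarrow> at.ge s 1 S"
    using error_signal_sensitivity[OF e v(1,2)] by metis
  obtain S0 where S0: "has_laplace e0 (W * S0)" "inf.ge 0 S0" "inf.ge (inf.val P') (1 - S0)"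
      "\<And>s. 0 \<le> Re s \<Longrightarrow> at.ge s 0 (W * S0)"
      "\<And>s. 0 \<le> Re s \<Longrightarrow> is_zero_of P' s \<Longrightarrow> at.ge s 1 (1 - S0)"
      "\<And>s. 0 \<le> Re s \<Longrightarrow> is_pole_of P' s \<Longrightarrow> at.ge s 1 S0"
    using error_signal_sensitivity[OF e0 v'(1,2)] by metis
  have eC: "e \<in> C0" "e0 \<in> C0" using e e0 by (auto simp: error_signals_def)
  then have ec: "continuous_on {0..} e" "continuous_on {0..} e0" by (auto simp: C0_def)
  have Wge: "inf.ge (int kw) W" using kw by (simp add: inf.ge_def)
  define G where "G = const_rat \<sigma> * (W * S0 - W * S)"
  have \<sigma>2: "const_rat \<sigma> * const_rat \<sigma> = 1" "\<sigma> * \<sigma> = 1"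
    using \<sigma> by (auto simp: One_fract_def eq_fract one_pCons)
  have const_at: "at.ge s 0 (const_rat \<sigma>)" for s
    using rat_eval_Fract(2)[of 1 s "[:\<sigma>:]"] by simp
  have scale: "has_laplace (\<lambda>t. \<sigma> * f t) (const_rat \<sigma> * F)" if "has_laplace f F" for f F
  proof -
    have "const_rat 1 = 1" "const_rat (-1) = -1"
      by (simp_all add: One_fract_def one_pCons)
    then show ?thesis using \<sigma> that has_laplace_uminus[OF that] by auto
  qed
  have G_at: "at.ge s 0 G" if "0 \<le> Re s" for s
    using at.ge_mult[OF const_at at.ge_diff[OF S0(4) S(4)], of s] that by (simp add: G_def)
  have G_inf: "inf.ge (int kw) G"
  proof -
    have "inf.ge (int kw + 0) (W * S0 - W * S)"
      by (rule inf.ge_diff[OF inf.ge_mult[OF Wge S0(2)] inf.ge_mult[OF Wge S(2)]])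
    from inf.ge_mult[OF const_rat_ge this] have "inf.ge (0 + (int kw + 0)) G" by (simp only: G_def)
    then show ?thesis by simp
  qed
  \<comment> \<open>The points at which the transform has to be prescribed.\<close>
  define A where "A = {s. 0 < Re s \<and> (is_zero_of P' s \<or> is_pole_of P' s) \<and> at.ge s 0 W}"
  have "finite ({s. is_zero_of P' s} \<union> {s. is_pole_of P' s})"
    unfolding is_zero_of_def is_pole_of_def using v'(1) by (simp add: poly_roots_finite)
  then have A: "finite A" by (rule finite_subset[rotated]) (auto simp: A_def)
  have high: "rat_eval G s = 0" if s: "s \<in> A" "\<gamma> \<le> ereal (Re s)" for s
  proof -
    have Re: "0 \<le> Re s" and W: "at.ge s 0 W" using s(1) by (auto simp: A_def)
    have "at.ge s 1 (S0 - S)"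
    proof (cases "is_zero_of P' s")
      case True
      then have "s \<in> Z" using P' s(2) by (auto simp: plant_class_def)
      then have "is_zero_of P s" using P by (auto simp: plant_class_def)
      from at.ge_diff[OF S(5)[OF Re this] S0(5)[OF Re True]]
      have "at.ge s 1 ((1 - S) - (1 - S0))" .
      then show ?thesis by simp
    next
      case False
      then have p: "is_pole_of P' s" using s(1) by (auto simp: A_def)
      then have "s \<in> Q" using P' s(2) by (auto simp: plant_class_def)
      then have "is_pole_of P s" using P by (auto simp: plant_class_def)
      then show ?thesis using S(6) S0(6) Re p by (intro at.ge_diff) auto
    qed
    from at.ge_mult[OF const_at at.ge_mult[OF W this]] have "at.ge s 1 G"
      by (simp add: G_def right_diff_distrib)
    then show ?thesis using rat_eval_eq_0_iff[OF G_at[OF Re]] by simp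
  qed
  have low: "Im s \<noteq> 0" if s: "s \<in> A" "ereal (Re s) < \<gamma>" for s
  proof
    assume "Im s = 0"
    then have "s = of_real (Re s)" by (simp add: complex_eq_iff)
    then have "plant_gamma P' \<le> ereal (Re s)"
      unfolding plant_gamma_def using s(1) by (intro Inf_lower) (auto simp: A_def)
    then show False using s(2) P' by (auto simp: plant_class_def)
  qed
  \<comment> \<open>The behaviour at infinity, which fixes the first derivatives at time zero.\<close>
  define N where "N = kw + nat (inf.val P')"
  have N: "int N = inf.val W + \<bar>inf.val P'\<bar>" using v'(2) kw(3) by (simp add: N_def)
  obtain r where r: "poly r 0 = 0" "inf.ge (int N) (exp_transform r - G)"
    and r1: "0 \<le> poly r 1 \<or> - poly r 1 \<le> y 0"
  proof (cases "N = 1")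
    case True
    then have "kw = 1" using kw(1) by (simp add: N_def)
    then show ?thesis using that[of 0] G_inf True by (simp add: exp_transform_def fract_collapse)
  next
    case False
    obtain r where r: "poly r 0 = 0" "inf.ge (int N) (exp_transform r - G)"
      using match_at_infinity[of G N] inf.ge_mono[OF G_inf, of 1] kw(1) by auto
    have N2: "2 \<le> N" using False kw(1) by (simp add: N_def)
    have "has_laplace (\<lambda>t. poly r (exp (- t)) - \<sigma> * (e0 t - e t)) (exp_transform r - G)"
      unfolding G_def by (intro has_laplace_diff has_laplace_poly_exp scale r(1) S(1) S0(1))
    then have "poly r (exp (- 0)) - \<sigma> * (e0 0 - e 0) = 0"
      using N2 ec inf.ge_mono[OF r(2), of 2]
      by (rule_tac initial_value_zero) (auto intro!: continuous_intros)
    then have c: "poly r 1 = \<sigma> * (e0 0 - e 0)" by simp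
    \<comment> \<open>A signal whose transform decays like \<open>s\<^sup>-\<^sup>2\<close> starts at zero; the transforms of the
      errors and of the tracking defects \<open>w - e\<close> do so as soon as \<open>W\<close> or the plant forces it.\<close>
    have start_zero: "f 0 = 0" if "2 \<le> kw" "continuous_on {0..} f" "has_laplace f (W * R)" "inf.ge 0 R" for f R
    proof (rule initial_value_zero[OF that(2,3)])
      show "inf.ge 2 (W * R)" using inf.ge_mono[OF inf.ge_mult[OF Wge that(4)], of 2] that(1) by simp
    qed
    have start_w: "f 0 = w 0"
      if "continuous_on {0..} f" "has_laplace f (W * R)" "inf.ge 1 (1 - R)" for f R
    proof -
      have "inf.ge (int kw + 1) (W * (1 - R))" by (rule inf.ge_mult[OF Wge that(3)])
      then have "inf.ge 2 (W - W * R)"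
        using inf.ge_mono[of "int kw + 1" _ 2] kw(1) by (simp add: right_diff_distrib)
      then have "w 0 - f 0 = 0"
        using wc that(1) has_laplace_diff[OF wl that(2)]
        by (rule_tac initial_value_zero) (auto intro!: continuous_intros)
      then show ?thesis by simp
    qed
    have "0 \<le> poly r 1 \<or> - poly r 1 \<le> y 0"
    proof (cases "2 \<le> kw")
      case True
      then show ?thesis using c start_zero[OF True ec(1) S(1,2)] start_zero[OF True ec(2) S0(1,2)] by simp
    next
      case False
      then have p': "1 \<le> inf.val P'" using N2 by (simp add: N_def)
      have e0w: "e0 0 = w 0" using start_w[OF ec(2) S0(1)] inf.ge_mono[OF S0(3) p'] by blast
      show ?thesis
      proof (cases "zero_at_infinity P 0")
        case True
        have "\<not> zero_at_infinity P' 0" using p' by (simp add: zero_at_infinity_iff)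
        then show ?thesis using start[OF True] c e0w by simp
      next
        case False
        then have "1 \<le> inf.val P" using v(1,2) by (simp add: zero_at_infinity_iff)
        then have "e 0 = w 0" using start_w[OF ec(1) S(1)] inf.ge_mono[OF S(3)] by blast
        then show ?thesis using c e0w by simp
      qed
    qed
    then show ?thesis using that r by blast
  qed
  have \<epsilon>2: "0 < \<epsilon> / 2" using \<epsilon> by simp
  obtain k0 where k0: "\<And>k t. k0 \<le> k \<Longrightarrow> 0 \<le> t \<Longrightarrow>
      - max (y t) 0 - \<epsilon> / 2 \<le> poly r 1 * exp (- (real k * t))"
    using dominated_by_barrier[OF y r1 \<epsilon>2] by blast
  have barrier: "(- max (y t) 0 - \<epsilon>) + \<epsilon> / 2 \<le> poly r 1 * exp (- (real k * t))"
    if "k0 \<le> k" "0 \<le> t" for k t using k0[OF that] by simp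
  have Apos: "0 < Re s" if "s \<in> A" for s using that by (simp add: A_def)
  obtain p where p: "poly p 0 = 0" "[:-1, 1:] ^ N dvd p - r"
      "\<And>t. 0 \<le> t \<Longrightarrow> - max (y t) 0 - \<epsilon> \<le> poly p (exp (- t))"
      "\<And>s. s \<in> A \<Longrightarrow> rat_eval (exp_transform p) s = rat_eval G s"
    by (rule one_sided_interpolation[where A = A and g = "rat_eval G" and \<gamma> = \<gamma> and r = r
      and \<eta> = "\<epsilon> / 2" and \<beta> = "\<lambda>t. - max (y t) 0 - \<epsilon>" and m = N and ?k0.0 = k0, OF A Apos rat_eval_cnj high low r(1) \<epsilon>2 barrier]) blast+
  define D where "D = const_rat \<sigma> * (exp_transform p - G)"
  define e' where "e' t = e t + \<sigma> * poly p (exp (- t))" for t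
  let ?f = "\<lambda>t. \<sigma> * (poly p (exp (- t)) - \<sigma> * (e0 t - e t))"
  have "(\<lambda>t. e0 t + ?f t) \<in> error_signals W P'"
  proof (rule error_signals_perturb[OF e0 v'(1) kw(2)])
    show "has_laplace ?f D"
      unfolding D_def G_def
      by (intro scale has_laplace_diff has_laplace_poly_exp p(1) S(1) S0(1))
    have "((\<lambda>t. poly p (exp (- t))) \<longlongrightarrow> poly p 0) at_top"
      by (intro tendsto_intros filterlim_compose[OF exp_at_bot] filterlim_uminus_at_bot_at_top)
    then have "(?f \<longlongrightarrow> \<sigma> * (0 - \<sigma> * (0 - 0))) at_top"
      using eC p(1) by (intro tendsto_intros) (auto simp: C0_def)
    then show "?f \<in> C0" using ec by (auto simp: C0_def intro!: continuous_intros)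
    have "inf.ge (int N) (exp_transform (p - r) + (exp_transform r - G))"
    proof (rule inf.ge_add[OF _ r(2)])
      have "poly (p - r) 0 = 0" using p(1) r(1) by simp
      then show "inf.ge (int N) (exp_transform (p - r))"
        using exp_transform_flat[OF _ p(2)] inf.ge_mono by fastforce
    qed
    then have "inf.ge (int N) (exp_transform p - G)" by (simp add: exp_transform_diff)
    from inf.ge_mult[OF const_rat_ge this] show "inf.ge (inf.val W + \<bar>inf.val P'\<bar>) D"
      by (simp add: D_def N[symmetric])
    fix s :: complex assume s: "0 \<le> Re s"
    note T = exp_transform_regular(1)[OF p(1) s]
    have "at.ge s 0 (exp_transform p - G)" by (rule at.ge_diff[OF T G_at[OF s]])
    from at.ge_mult[OF const_at this] have D0: "at.ge s 0 D" by (simp add: D_def)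
    have W: "at.val s W \<le> 0"
      using w(2) s kw(2) by (auto simp: minimum_phase_def zero_iff at.ge_def)
    show "at.ge s (at.val s W + \<bar>at.val s P'\<bar>) D"
    proof (cases "at.val s P' = 0 \<or> at.val s W < 0")
      case True
      then have "at.val s W + \<bar>at.val s P'\<bar> \<le> 0" using W v'(3)[OF s] by auto
      then show ?thesis by (rule at.ge_mono[OF D0])
    next
      case False
      then have "s \<in> A" using v'(4)[OF s] by (auto simp: A_def at.ge_def)
      then have "rat_eval (exp_transform p - G) s = 0"
        using p(4) by (simp add: rat_eval_diff[OF T G_at[OF s]])
      then have "at.ge s 1 (exp_transform p - G)"
        using rat_eval_eq_0_iff[OF at.ge_diff[OF T G_at[OF s]]] by simp
      from at.ge_mult[OF const_at this] have "at.ge s 1 D" by (simp add: D_def)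
      then show ?thesis by (rule at.ge_mono) (use W v'(3)[OF s] in linarith)
    qed
  qed
  moreover have "(\<lambda>t. e0 t + ?f t) = e'"
  proof
    fix t
    have "?f t = \<sigma> * poly p (exp (- t)) - (\<sigma> * \<sigma>) * (e0 t - e t)" by (simp only: algebra_simps)
    then show "e0 t + ?f t = e' t" by (simp add: e'_def \<sigma>2(2))
  qed
  ultimately have "e' \<in> error_signals W P'" by simp
  moreover have "\<sigma> * (e' t - e t) = poly p (exp (- t))" for t
    by (simp add: e'_def \<sigma>2(2) flip: mult.assoc)
  ultimately show ?thesis using p(3) by (intro bexI[of _ e']) auto
qed

lemma INF_SUP_le:
  fixes F F' :: "'a set" and \<phi> :: "'a \<Rightarrow> real \<Rightarrow> real"
  assumes "\<And>e \<epsilon>. e \<in> F \<Longrightarrow> 0 < \<epsilon> \<Longrightarrow> \<exists>e'\<in>F'. \<forall>t\<ge>0. \<phi> e' t \<le> \<phi> e t + \<epsilon>"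
  shows "(INF e\<in>F'. SUP t\<in>{0..}. ereal (\<phi> e t)) \<le> (INF e\<in>F. SUP t\<in>{0..}. ereal (\<phi> e t))"
proof (rule INF_greatest, rule ereal_le_epsilon2)
  fix e assume e: "e \<in> F"
  show "(INF e\<in>F'. SUP t\<in>{0..}. ereal (\<phi> e t)) \<le> (SUP t\<in>{0..}. ereal (\<phi> e t)) + ereal \<epsilon>"
    if \<epsilon>: "0 < \<epsilon>" for \<epsilon>
  proof -
    from \<epsilon> obtain e' where e': "e' \<in> F'" "\<And>t. 0 \<le> t \<Longrightarrow> \<phi> e' t \<le> \<phi> e t + \<epsilon>"
      using assms[OF e] by blast
    have "(INF e\<in>F'. SUP t\<in>{0..}. ereal (\<phi> e t)) \<le> (SUP t\<in>{0..}. ereal (\<phi> e' t))"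
      using e'(1) by (rule INF_lower)
    also have "\<dots> \<le> (SUP t\<in>{0..}. ereal (\<phi> e t)) + ereal \<epsilon>"
    proof (rule SUP_least)
      fix t :: real assume t: "t \<in> {0..}"
      have "ereal (\<phi> e' t) \<le> ereal (\<phi> e t) + ereal \<epsilon>" using e'(2)[of t] t by simp
      also have "\<dots> \<le> (SUP t\<in>{0..}. ereal (\<phi> e t)) + ereal \<epsilon>"
        by (intro add_right_mono SUP_upper t)
      finally show "ereal (\<phi> e' t) \<le> (SUP t\<in>{0..}. ereal (\<phi> e t)) + ereal \<epsilon>" .
    qed
    finally show "(INF e\<in>F'. SUP t\<in>{0..}. ereal (\<phi> e t)) \<le> (SUP t\<in>{0..}. ereal (\<phi> e t)) + ereal \<epsilon>" .
  qed
qed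

lemma OS_opt_le:
  assumes "reference_input w W" "minimum_phase W"
    and "P \<in> plant_class \<gamma> Z Q" "P' \<in> plant_class \<gamma> Z Q" "error_signals W P' \<noteq> {}"
    and start: "w 0 < 0 \<Longrightarrow> zero_at_infinity P 0 \<Longrightarrow> zero_at_infinity P' 0"
  shows "OS_opt W P' \<le> OS_opt W P"
  unfolding OS_opt_def
proof (rule INF_SUP_le)
  fix e and \<epsilon> :: real assume e: "e \<in> error_signals W P" and \<epsilon>: "0 < \<epsilon>"
  have "continuous_on {0..} e" using e by (simp add: error_signals_def C0_def)
  moreover have "0 \<le> 1 * (w 0 - e 0) \<or> - (1 * (w 0 - e 0)) \<le> e 0"
    if "zero_at_infinity P 0" "\<not> zero_at_infinity P' 0"
  proof -
    have "0 \<le> w 0" using start that by force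
    then show ?thesis by simp
  qed
  ultimately obtain e' where e': "e' \<in> error_signals W P'"
      "\<And>t. 0 \<le> t \<Longrightarrow> - max (e t) 0 - \<epsilon> \<le> 1 * (e' t - e t)"
    using transfer_error_signal[OF assms(1-4) e assms(5), of 1 \<epsilon> e] \<epsilon> by blast
  have "max (- e' t) 0 \<le> max (- e t) 0 + \<epsilon>" if "0 \<le> t" for t
  proof -
    have "- max (e t) 0 - \<epsilon> \<le> e' t - e t" using e'(2)[OF that] by simp
    then show ?thesis using \<epsilon> by linarith
  qed
  then show "\<exists>e'\<in>error_signals W P'. \<forall>t\<ge>0. max (- e' t) 0 \<le> max (- e t) 0 + \<epsilon>"
    using e'(1) by blast
qed

lemma US_opt_le:
  assumes "reference_input w W" "minimum_phase W"
    and "P \<in> plant_class \<gamma> Z Q" "P' \<in> plant_class \<gamma> Z Q" "error_signals W P' \<noteq> {}"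
  shows "US_opt w W P' \<le> US_opt w W P"
  unfolding US_opt_def
proof (rule INF_SUP_le)
  fix e and \<epsilon> :: real assume e: "e \<in> error_signals W P" and \<epsilon>: "0 < \<epsilon>"
  have "continuous_on {0..} e" using e by (simp add: error_signals_def C0_def)
  moreover have "continuous_on {0..} w" using assms(1) by (simp add: reference_input_def)
  ultimately have "continuous_on {0..} (\<lambda>t. w t - e t)" by (intro continuous_intros)
  moreover have "0 \<le> - 1 * (w 0 - e 0) \<or> - (- 1 * (w 0 - e 0)) \<le> w 0 - e 0" by simp
  ultimately obtain e' where e': "e' \<in> error_signals W P'"
      "\<And>t. 0 \<le> t \<Longrightarrow> - max (w t - e t) 0 - \<epsilon> \<le> - 1 * (e' t - e t)"
    using transfer_error_signal[OF assms(1-4) e assms(5), of "-1" \<epsilon> "\<lambda>t. w t - e t"] \<epsilon> by blast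
  have "max (e' t - w t) 0 \<le> max (e t - w t) 0 + \<epsilon>" if "0 \<le> t" for t
  proof -
    have "- max (w t - e t) 0 - \<epsilon> \<le> e t - e' t" using e'(2)[OF that] by simp
    then show ?thesis using \<epsilon> by linarith
  qed
  then show "\<exists>e'\<in>error_signals W P'. \<forall>t\<ge>0. max (e' t - w t) 0 \<le> max (e t - w t) 0 + \<epsilon>"
    using e'(1) by blast
qed

theorem theorem4p5:
  fixes w :: "real \<Rightarrow> real" and W :: ratfun and \<gamma> :: ereal and Z Q :: "complex set"
  assumes "reference_input w W"
    and "minimum_phase W"
  shows "\<forall>P \<in> plant_class \<gamma> Z Q. \<forall>P' \<in> plant_class \<gamma> Z Q.
           error_signals W P \<noteq> {} \<and> error_signals W P' \<noteq> {} \<longrightarrow>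
             ((w 0 < 0 \<longrightarrow> (zero_at_infinity P 0 \<longleftrightarrow> zero_at_infinity P' 0)) \<longrightarrow>
                OS_opt W P = OS_opt W P') \<and>
             ((\<forall>t\<ge>0. w t \<ge> 0) \<longrightarrow> US_opt w W P = US_opt w W P')"
  using OS_opt_le[OF assms] US_opt_le[OF assms] by (blast intro: antisym)

end
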